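(* Let $\mathfrak g$ be a complex simple Lie algebra of type $A_\ell$ with $\ell$ odd, $D_\ell$ ($\ell\ge4$), $E_6$, $E_7$ or $E_8$, of rank $\ell$, with (even) Coxeter number $h$, $g=h/2$, and with $\Delta_+$, $\beta_i$ ($i\in I=\{1,\dots,\ell\}$), $\sigma$ and $Z$ as in the context. For $i\in I$ put $(Z\cdot\beta_i)_+=\Delta_+\cap Z\cdot\beta_i$. Then for every $i\in I$ one has $\operatorname{card}(Z\cdot\beta_i)_+=g$, and one has the disjoint union $$\Delta_+=\bigsqcup_{i\in I}(Z\cdot\beta_i)_+.$$
   Context: Let $\Delta$ be the roots of $\mathfrak g$ with respect to a Cartan subalgebra, $\Delta_+$ a choice of positive roots, $\Pi=\{\alpha_i\mid i\in I\}$ the simple roots, $W$ the Weyl group, $\psi$ the highest root, and $h$ the Coxeter number (so $\ell(h+1)=\dim\mathfrak g$). There is a unique partition $\Pi=\Pi_1\cup\Pi_2$, with $\Pi_k=\{\alpha_i\mid i\in I_k\}$ and $I=I_1\sqcup I_2$, such that distinct roots in the same $\Pi_k$ are orthogonal and all roots in $\Pi_2$ are orthogonal to $\psi$ ($\Pi_2$ may be empty, for $A_1$). Let $s_i\in W$ be the reflection in $\alpha_i$, $\tau_k=\prod_{i\in I_k}s_i$ for $k=1,2$, $\sigma=\tau_2\tau_1$ (a Coxeter element), and $Z\subset W$ the cyclic group generated by $\sigma$. Put $\beta_i=\alpha_i$ if $i\in I_1$ and $\beta_i=-\alpha_i$ if $i\in I_2$. *)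

theory Defs
  imports Complex_Main "HOL-Library.Function_Algebras" "HOL-Library.Disjoint_Sets"
begin

locale lie_algebra = vector_space scale
  for scale :: "complex \<Rightarrow> 'a::ab_group_add \<Rightarrow> 'a" (infixr "*s" 75) +
  fixes bracket :: "'a \<Rightarrow> 'a \<Rightarrow> 'a"
  assumes bracket_add_left: "bracket (x + y) z = bracket x z + bracket y z"
    and bracket_add_right: "bracket x (y + z) = bracket x y + bracket x z"
    and bracket_scale_left: "bracket (c *s x) y = c *s bracket x y"
    and bracket_scale_right: "bracket x (c *s y) = c *s bracket x y"
    and bracket_self: "bracket x x = 0"
    and jacobi: "bracket x (bracket y z) + bracket y (bracket z x) + bracket z (bracket x y) = 0"
begin

definition finite_dimensional :: bool where
  "finite_dimensional \<longleftrightarrow> (\<exists>B. finite B \<and> span B = UNIV)"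

definition ideal :: "'a set \<Rightarrow> bool" where
  "ideal J \<longleftrightarrow> subspace J \<and> (\<forall>x. \<forall>y\<in>J. bracket x y \<in> J)"

definition simple :: bool where
  "simple \<longleftrightarrow> (\<exists>x y. bracket x y \<noteq> 0) \<and> (\<forall>J. ideal J \<longrightarrow> J = {0} \<or> J = UNIV)"

definition subalgebra :: "'a set \<Rightarrow> bool" where
  "subalgebra H \<longleftrightarrow> subspace H \<and> (\<forall>x\<in>H. \<forall>y\<in>H. bracket x y \<in> H)"

primrec lower_central_series :: "'a set \<Rightarrow> nat \<Rightarrow> 'a set" where
  "lower_central_series H 0 = H"
| "lower_central_series H (Suc n) =
     span {bracket x y | x y. x \<in> H \<and> y \<in> lower_central_series H n}"

definition cartan_subalgebra :: "'a set \<Rightarrow> bool" where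
  "cartan_subalgebra H \<longleftrightarrow>
     subalgebra H \<and>
     (\<exists>n. lower_central_series H n = {0}) \<and>
     {x. \<forall>y\<in>H. bracket x y \<in> H} = H"

definition trace :: "('a \<Rightarrow> 'a) \<Rightarrow> complex" where
  "trace f = (let B = (SOME B. independent B \<and> span B = UNIV) in
                \<Sum>b\<in>B. representation B (f b) b)"

definition killing_form :: "'a \<Rightarrow> 'a \<Rightarrow> complex" where
  "killing_form x y = trace (\<lambda>z. bracket x (bracket y z))"

text \<open>A linear functional on a subspace \<open>H\<close> is represented by the function on the whole space
  that extends it by zero outside \<open>H\<close>, so that functionals on \<open>H\<close> are equal iff they are equal as
  functions.\<close>

definition dual :: "'a set \<Rightarrow> ('a \<Rightarrow> complex) set" where
  "dual H = {f. (\<forall>x\<in>H. \<forall>y\<in>H. f (x + y) = f x + f y) \<and>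
                (\<forall>c. \<forall>x\<in>H. f (c *s x) = c * f x) \<and>
                (\<forall>x. x \<notin> H \<longrightarrow> f x = 0)}"

definition roots :: "'a set \<Rightarrow> ('a \<Rightarrow> complex) set" where
  "roots H = {\<alpha> \<in> dual H. \<alpha> \<noteq> 0 \<and> (\<exists>x. x \<noteq> 0 \<and> (\<forall>y\<in>H. bracket y x = \<alpha> y *s x))}"

definition killing_dual :: "'a set \<Rightarrow> ('a \<Rightarrow> complex) \<Rightarrow> 'a" where
  "killing_dual H \<mu> = (THE t. t \<in> H \<and> (\<forall>x\<in>H. killing_form t x = \<mu> x))"

text \<open>The form on the dual of \<open>H\<close> induced by the Killing form \<open>\<kappa>\<close>: with \<open>t\<close> the identification of
  the dual with \<open>H\<close>, it is \<open>\<kappa> (t \<nu>) (t \<mu>)\<close>, which is \<open>\<nu> (t \<mu>)\<close> by the definition of \<open>t \<nu>\<close>.\<close>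

definition dual_form :: "'a set \<Rightarrow> ('a \<Rightarrow> complex) \<Rightarrow> ('a \<Rightarrow> complex) \<Rightarrow> complex" where
  "dual_form H \<nu> \<mu> = \<nu> (killing_dual H \<mu>)"

definition cartan_number :: "'a set \<Rightarrow> ('a \<Rightarrow> complex) \<Rightarrow> ('a \<Rightarrow> complex) \<Rightarrow> complex" where
  "cartan_number H \<nu> \<alpha> = 2 * dual_form H \<nu> \<alpha> / dual_form H \<alpha> \<alpha>"

definition root_reflection :: "'a set \<Rightarrow> ('a \<Rightarrow> complex) \<Rightarrow> ('a \<Rightarrow> complex) \<Rightarrow> ('a \<Rightarrow> complex)" where
  "root_reflection H \<alpha> \<nu> = (\<lambda>x. \<nu> x - cartan_number H \<nu> \<alpha> * \<alpha> x)"

end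

definition positive_system :: "('a \<Rightarrow> complex) set \<Rightarrow> ('a \<Rightarrow> complex) set \<Rightarrow> bool" where
  "positive_system \<Delta> P \<longleftrightarrow>
     P \<union> uminus ` P = \<Delta> \<and> P \<inter> uminus ` P = {} \<and>
     (\<forall>\<alpha>\<in>P. \<forall>\<beta>\<in>P. \<alpha> + \<beta> \<in> \<Delta> \<longrightarrow> \<alpha> + \<beta> \<in> P)"

definition simple_roots :: "('a \<Rightarrow> complex) set \<Rightarrow> ('a \<Rightarrow> complex) set" where
  "simple_roots P = {\<alpha> \<in> P. \<not> (\<exists>\<beta>\<in>P. \<exists>\<gamma>\<in>P. \<alpha> = \<beta> + \<gamma>)}"

definition highest_root ::
  "('a \<Rightarrow> complex) set \<Rightarrow> ('a \<Rightarrow> complex) set \<Rightarrow> ('a \<Rightarrow> complex) \<Rightarrow> bool" where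
  "highest_root \<Delta> P \<psi> \<longleftrightarrow>
     \<psi> \<in> \<Delta> \<and>
     (\<forall>\<beta>\<in>\<Delta>. \<exists>n :: ('a \<Rightarrow> complex) \<Rightarrow> nat.
        \<psi> = (\<lambda>x. \<beta> x + (\<Sum>\<gamma>\<in>simple_roots P. of_nat (n \<gamma>) * \<gamma> x)))"

text \<open>Used only for pairwise commuting reflections, so that the order of the factors is
  immaterial.\<close>

definition ordered_product :: "(nat \<Rightarrow> 'b \<Rightarrow> 'b) \<Rightarrow> nat set \<Rightarrow> 'b \<Rightarrow> 'b" where
  "ordered_product s J = foldr (\<lambda>i f. s i \<circ> f) (sorted_list_of_set J) id"

definition cyclic_group :: "('b \<Rightarrow> 'b) \<Rightarrow> ('b \<Rightarrow> 'b) set" where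
  "cyclic_group f = range (\<lambda>n. f ^^ n) \<union> range (\<lambda>n. inv f ^^ n)"

definition orbit_of :: "('b \<Rightarrow> 'b) set \<Rightarrow> 'b \<Rightarrow> 'b set" where
  "orbit_of G x = (\<lambda>g. g x) ` G"

text \<open>The Coxeter number is the order of a Coxeter element, a product of the simple reflections,
  each taken once, acting on the dual of the Cartan subalgebra.\<close>

definition order_on :: "'b set \<Rightarrow> ('b \<Rightarrow> 'b) \<Rightarrow> nat" where
  "order_on S f = (LEAST n. 0 < n \<and> (\<forall>x\<in>S. (f ^^ n) x = x))"

text \<open>The standard root systems of types A, D and E, as finitely supported real sequences with
  coordinates numbered from 0: \<open>A_roots l\<close> has rank \<open>l\<close> and lives in the first \<open>l + 1\<close>
  coordinates, \<open>D_roots l\<close> in the first \<open>l\<close>, the others in the first 8.  The vectors of \<open>E8_roots\<close>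
  that are not in \<open>D_roots 8\<close> have all coordinates \<open>1/2\<close> or \<open>-1/2\<close>, with an even number of minus
  signs.\<close>

definition unit_vec :: "nat \<Rightarrow> nat \<Rightarrow> real" where
  "unit_vec i = (\<lambda>k. if k = i then 1 else 0)"

definition A_roots :: "nat \<Rightarrow> (nat \<Rightarrow> real) set" where
  "A_roots l = {unit_vec i - unit_vec j | i j. i \<le> l \<and> j \<le> l \<and> i \<noteq> j}"

definition D_roots :: "nat \<Rightarrow> (nat \<Rightarrow> real) set" where
  "D_roots l = {(\<lambda>k. a * unit_vec i k + b * unit_vec j k) | a b i j.
                  a \<in> {1, -1} \<and> b \<in> {1, -1} \<and> i < l \<and> j < l \<and> i \<noteq> j}"

definition E8_roots :: "(nat \<Rightarrow> real) set" where
  "E8_roots = D_roots 8 \<union>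
     {v. (\<forall>k<8. v k \<in> {1/2, -1/2}) \<and> (\<forall>k\<ge>8. v k = 0) \<and> even (card {k. k < 8 \<and> v k < 0})}"

definition E7_roots :: "(nat \<Rightarrow> real) set" where
  "E7_roots = {v \<in> E8_roots. v 6 = - v 7}"

definition E6_roots :: "(nat \<Rightarrow> real) set" where
  "E6_roots = {v \<in> E8_roots. v 5 = v 6 \<and> v 6 = - v 7}"

definition dot :: "(nat \<Rightarrow> real) \<Rightarrow> (nat \<Rightarrow> real) \<Rightarrow> real" where
  "dot x y = (\<Sum>k\<in>{k. x k \<noteq> 0 \<and> y k \<noteq> 0}. x k * y k)"

definition real_scale :: "real \<Rightarrow> ('x \<Rightarrow> 'b::real_vector) \<Rightarrow> 'x \<Rightarrow> 'b" where
  "real_scale r f = (\<lambda>x. r *\<^sub>R f x)"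

text \<open>The roots with respect to \<open>H\<close> form a root system isomorphic to \<open>\<Phi>\<close>: there is an isomorphism
  from the real span of the roots onto the real span of \<open>\<Phi>\<close> that maps the roots onto \<open>\<Phi>\<close> and
  preserves the Cartan integers.  It is given here by a real-linear extension \<open>\<phi>\<close> to the space of
  all functions, on which no other condition is imposed.\<close>

definition (in lie_algebra) has_root_system :: "'a set \<Rightarrow> (nat \<Rightarrow> real) set \<Rightarrow> bool" where
  "has_root_system H \<Phi> \<longleftrightarrow>
     (\<exists>\<phi> :: ('a \<Rightarrow> complex) \<Rightarrow> (nat \<Rightarrow> real).
        Vector_Spaces.linear real_scale real_scale \<phi> \<and>
        inj_on \<phi> (module.span real_scale (roots H)) \<and>
        \<phi> ` roots H = \<Phi> \<and>
        (\<forall>\<alpha>\<in>roots H. \<forall>\<beta>\<in>roots H.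
           cartan_number H \<alpha> \<beta> = of_real (2 * dot (\<phi> \<alpha>) (\<phi> \<beta>) / dot (\<phi> \<beta>) (\<phi> \<beta>))))"

end

theory Submission
  imports Defs "HOL-Analysis.Function_Topology"
begin

text \<open>Let \<open>\<gamma>\<^sub>t\<close> run over the roots \<open>\<tau>1 \<tau>2 \<tau>1 \<dots> (\<alpha>\<^sub>i)\<close> with \<open>t\<close> alternating factors, \<open>i\<close> in the part
  whose turn comes next.  A Perron eigenvector of the Dynkin diagram yields a linear functional,
  positive on the positive roots, whose value at such a root is \<open>u\<^sub>t\<close> times its value at \<open>\<alpha>\<^sub>i\<close>, with \<open>u\<^sub>t\<close>
  independent of \<open>i\<close> and of the part one starts from.  So for the first \<open>m\<close> with \<open>u\<^sub>m \<le> 0\<close> all these roots are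
  positive for \<open>t < m\<close>, and the alternating product of \<open>m\<close> factors makes every positive root negative.
  Hence the \<open>\<gamma>\<^sub>t\<close> with \<open>t < m\<close> enumerate the positive roots without repetition; \<open>\<sigma>\<^sup>m\<close> preserves
  positivity and is therefore the identity, so \<open>m\<close> is the Coxeter number.  Up to the shift built into
  \<open>\<beta>\<^sub>i\<close>, the orbit of \<open>\<beta>\<^sub>i\<close> consists of the \<open>\<gamma>\<^sub>t\<close> belonging to \<open>i\<close>, and for even \<open>m\<close> exactly half of the
  \<open>t < m\<close> have the right parity.  Evenness of \<open>m\<close> follows from \<open>card \<Delta> = m l\<close> and the number of roots.\<close>

subsection \<open>Perron eigenvectors\<close>

text \<open>Every neighbour of a node lies in the other part, so the functionals that are, on each
  part separately, a multiple of the Perron functional are preserved by both partial Coxeter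
  elements; that is why one number \<open>u\<^sub>t\<close> serves all \<open>i\<close>. The
  eigenvalue is never computed, and \<open>u\<^sub>m\<close> is not shown to vanish: a functional
  positive on the positive roots is nonzero on all roots, so a weak inequality already fixes signs.
  Such an \<open>m\<close> exists because the roots stay distinct as long as they stay positive, and
  there are finitely many roots. The Lie algebra is seen only through its Cartan numbers: the
  isomorphism with a standard model supplies a form \<open>B\<close> of norm 2 on the roots, and the
  argument runs on \<open>B\<close>. A positive Perron vector needs a connected diagram, and
  connectedness is read off from the highest root. The Coxeter number is defined by the action on
  the whole dual of \<open>H\<close>, so the action on roots is spread by linearity, which requires
  the simple roots to span the dual.\<close>

lemma linear_coeff_zero:
  fixes b d :: real
  assumes "\<And>t. 0 \<le> 2 * t * b + t\<^sup>2 * d"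
  shows "b = 0"
proof (rule ccontr)
  assume b: "b \<noteq> 0"
  \<comment> \<open>The hypothesis says that t = 0 minimises the quadratic. A positive
    \<open>D\<close> bounding \<open>d\<close> makes t = -b/D a point with value at most -b^2/D,
    whatever the sign of \<open>d\<close>.\<close>
  define D where "D = \<bar>d\<bar> + 1"
  have D: "D > 0" "d \<le> D" by (auto simp: D_def)
  have "0 \<le> 2 * (- b / D) * b + (- b / D)\<^sup>2 * d" by (rule assms)
  also have "\<dots> \<le> 2 * (- b / D) * b + (- b / D)\<^sup>2 * D"
    using D by (intro add_left_mono mult_left_mono) auto
  also have "\<dots> = - (b\<^sup>2 / D)"
    using D by (simp add: power2_eq_square)
  also have "\<dots> < 0" using b D by simp
  finally show False by simp
qed

text \<open>The maximum of the Rayleigh quotient is attained at a nonnegative vector, which is then an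
  eigenvector; connectedness spreads its positivity over the whole index set.\<close>

lemma Perron_eigenvector:
  fixes a :: "'i \<Rightarrow> 'i \<Rightarrow> real"
  assumes fin: "finite I" and ne: "I \<noteq> {}"
    and sym: "\<And>i j. a i j = a j i" and nonneg: "\<And>i j. a i j \<ge> 0"
    and connected: "\<And>J. J \<subseteq> I \<Longrightarrow> J \<noteq> {} \<Longrightarrow> J \<noteq> I \<Longrightarrow> \<exists>i\<in>J. \<exists>j\<in>I-J. a i j > 0"
  obtains c :: "'i \<Rightarrow> real" and \<mu> :: real
  where "\<And>i. i \<in> I \<Longrightarrow> c i > 0" "\<And>j. j \<in> I \<Longrightarrow> (\<Sum>i\<in>I. a i j * c i) = \<mu> * c j"
proof -
  define N where "N x = (\<Sum>i\<in>I. (x i)\<^sup>2)" for x :: "'i \<Rightarrow> real"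
  define A where "A x = (\<Sum>i\<in>I. \<Sum>j\<in>I. a i j * x i * x j)" for x :: "'i \<Rightarrow> real"
  \<comment> \<open>The maximum is sought in the space of all functions on the index type, so
    coordinates outside \<open>I\<close> also need a compact range; they are pinned to 0.\<close>
  define K where "K = (\<lambda>i. if i \<in> I then {-1..1::real} else {0})"
  let ?C = "PiE UNIV K"
  have comp: "compact ?C"
    using compactin_PiE[of "\<lambda>_. euclidean" UNIV K]
    by (simp add: euclidean_product_topology K_def)
  have cont: "continuous_on UNIV N" "continuous_on UNIV A"
    unfolding N_def A_def by (intro continuous_intros; simp add: continuous_on_product_coordinates)+
  define S where "S = ?C \<inter> {x. N x = 1}"
  have "closed {x. N x = 1}"
    using closed_vimage[of "{1}" N] cont(1) by (simp add: vimage_def)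
  with comp have "compact S" unfolding S_def by (rule compact_Int_closed)
  moreover have "S \<noteq> {}"
  proof -
    obtain k where k: "k \<in> I" using ne by blast
    have "N (\<lambda>i. if i = k then 1 else 0) = 1"
      using fin k unfolding N_def by (simp add: if_distrib[of "\<lambda>x. x\<^sup>2"] cong: if_cong)
    then have "(\<lambda>i. if i = k then 1 else 0) \<in> S" using k by (auto simp: S_def K_def)
    then show ?thesis by blast
  qed
  moreover have "continuous_on S A" using cont(2) continuous_on_subset by blast
  ultimately obtain y where y: "y \<in> S" "\<And>x. x \<in> S \<Longrightarrow> A x \<le> A y"
    using continuous_attains_sup by metis
  define c where "c = (\<lambda>i. \<bar>y i\<bar>)"
  have cS: "c \<in> S" using y(1) by (force simp: S_def K_def c_def N_def PiE_iff split: if_splits)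
  have "A y \<le> A c"
    unfolding A_def c_def
    by (intro sum_mono) (metis (no_types, lifting) abs_ge_self abs_mult abs_of_nonneg nonneg)
  then have max: "A x \<le> A c" if "x \<in> S" for x using y(2)[OF that] by linarith
  define \<mu> where "\<mu> = A c"
  have quad: "A x \<le> \<mu> * N x" for x
  proof (cases "N x = 0")
    case True
    then have "\<And>i. i \<in> I \<Longrightarrow> x i = 0" using fin by (simp add: N_def sum_nonneg_eq_0_iff)
    then have "A x = 0" by (simp add: A_def)
    then show ?thesis using True by simp
  next
    case False
    moreover have "N x \<ge> 0" by (simp add: N_def sum_nonneg)
    ultimately have pos: "N x > 0" by simp
    define z where "z = (\<lambda>i. if i \<in> I then x i / sqrt (N x) else 0)"
    have Nz: "N z = 1"
      using pos by (simp add: N_def z_def power_divide flip: sum_divide_distrib)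
    have "-1 \<le> z i \<and> z i \<le> 1" if "i \<in> I" for i
    proof -
      have "(z i)\<^sup>2 \<le> N z" unfolding N_def by (rule member_le_sum) (use fin that in auto)
      then show ?thesis using Nz by (simp add: abs_square_le_1 abs_le_iff)
    qed
    moreover have "z i = 0" if "i \<notin> I" for i using that by (simp add: z_def)
    ultimately have "z \<in> S" using Nz by (simp add: S_def K_def PiE_iff)
    then have "A z \<le> \<mu>" unfolding \<mu>_def by (rule max)
    moreover have "A z = A x / N x"
      unfolding A_def sum_divide_distrib z_def using pos
      by (intro sum.cong refl) (simp add: field_simps)
    ultimately show ?thesis using pos by (simp add: field_simps)
  qed
  have Nc: "N c = 1" using cS by (simp add: S_def)
  have eig: "(\<Sum>i\<in>I. a i j * c i) = \<mu> * c j" if j: "j \<in> I" for j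
  proof -
    \<comment> \<open>First variation at the maximiser: \<open>\<mu> * N x - A x\<close> is
      nonnegative and zero at \<open>c\<close>, so along the \<open>j\<close>-th coordinate its
      linear coefficient in \<open>t\<close> vanishes.\<close>
    let ?e = "\<lambda>i. if i = j then 1 else 0 :: real"
    have "\<mu> * c j - (\<Sum>i\<in>I. a i j * c i) = 0"
    proof (rule linear_coeff_zero)
      fix t :: real
      have "N (\<lambda>i. c i + t * ?e i) = (\<Sum>i\<in>I. (c i)\<^sup>2 + (if i = j then 2 * t * c j + t\<^sup>2 else 0))"
        unfolding N_def by (intro sum.cong) (auto simp: power2_sum)
      then have 1: "N (\<lambda>i. c i + t * ?e i) = 1 + 2 * t * c j + t\<^sup>2"
        using fin j Nc by (simp add: sum.distrib N_def)
      have "A (\<lambda>i. c i + t * ?e i)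
          = (\<Sum>i\<in>I. (c i + t * ?e i) * (\<Sum>k\<in>I. a i k * c k + (if k = j then t * a i k else 0)))"
        unfolding A_def sum_distrib_left by (intro sum.cong) (auto simp: algebra_simps)
      also have "\<dots> = (\<Sum>i\<in>I. c i * (\<Sum>k\<in>I. a i k * c k) + t * (a i j * c i)
            + (if i = j then t * ((\<Sum>k\<in>I. a i k * c k) + t * a i j) else 0))"
        using fin j by (intro sum.cong) (auto simp: sum.distrib algebra_simps)
      also have "\<dots> = A c + t * (\<Sum>i\<in>I. a i j * c i) + t * ((\<Sum>k\<in>I. a j k * c k) + t * a j j)"
        using fin j by (simp add: sum.distrib A_def sum_distrib_left mult.assoc mult.left_commute)
      also have "(\<Sum>k\<in>I. a j k * c k) = (\<Sum>i\<in>I. a i j * c i)" using sym by metis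
      finally have "A (\<lambda>i. c i + t * ?e i) = \<mu> + 2 * t * (\<Sum>i\<in>I. a i j * c i) + t\<^sup>2 * a j j"
        by (simp add: \<mu>_def power2_eq_square algebra_simps)
      with quad[of "\<lambda>i. c i + t * ?e i"] 1
      show "0 \<le> 2 * t * (\<mu> * c j - (\<Sum>i\<in>I. a i j * c i)) + t\<^sup>2 * (\<mu> - a j j)"
        by (simp add: algebra_simps)
    qed
    then show ?thesis by simp
  qed
  have c0: "c i \<ge> 0" for i by (simp add: c_def)
  have "c i > 0" if "i \<in> I" for i
  proof (rule ccontr)
    assume "\<not> c i > 0"
    define J where "J = {i \<in> I. c i = 0}"
    have "J \<noteq> {}" using that \<open>\<not> c i > 0\<close> c0[of i] by (auto simp: J_def)
    moreover have "J \<noteq> I"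
    proof
      assume "J = I"
      then have "\<And>i. i \<in> I \<Longrightarrow> c i = 0" unfolding J_def by blast
      then show False using Nc by (simp add: N_def)
    qed
    ultimately obtain j k where jk: "j \<in> J" "k \<in> I - J" "a j k > 0"
      using connected[of J] by (auto simp: J_def)
    have "(\<Sum>i\<in>I. a i j * c i) = 0" using eig[of j] jk by (simp add: J_def)
    then have "a k j * c k = 0"
      using fin nonneg c0 jk by (subst (asm) sum_nonneg_eq_0_iff) auto
    then show False using jk sym[of k j] by (simp add: J_def)
  qed
  with eig that show thesis by blast
qed

subsection \<open>Simply laced root systems\<close>

text \<open>The additive monoid generated by \<open>S\<close>. Sums instead of coefficients let
  additive maps be compared by induction before the simple roots are known to be
  independent.\<close>

inductive_set nat_cone :: "'v::ab_group_add set \<Rightarrow> 'v set" for S where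
  zero: "0 \<in> nat_cone S"
| add: "x \<in> S \<Longrightarrow> y \<in> nat_cone S \<Longrightarrow> x + y \<in> nat_cone S"

lemma nat_cone_incl: "x \<in> S \<Longrightarrow> x \<in> nat_cone S"
  using nat_cone.add[OF _ nat_cone.zero] by fastforce

lemma nat_cone_plus: "x \<in> nat_cone S \<Longrightarrow> y \<in> nat_cone S \<Longrightarrow> x + y \<in> nat_cone S"
  by (induction rule: nat_cone.induct) (auto simp: add.assoc intro: nat_cone.add)

lemma nat_cone_Un: "x \<in> nat_cone (S \<union> T) \<Longrightarrow> \<exists>y\<in>nat_cone S. \<exists>z\<in>nat_cone T. x = y + z"
proof (induction rule: nat_cone.induct)
  case zero
  show ?case by (metis add_0 nat_cone.zero)
next
  case (add x y)
  then obtain u v where "u \<in> nat_cone S" "v \<in> nat_cone T" "y = u + v" by blast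
  with add(1) show ?case
    by (metis Un_iff add.assoc add.left_commute nat_cone.add)
qed

lemma nat_cone_nonneg:
  fixes F :: "'v::ab_group_add \<Rightarrow> real"
  assumes "x \<in> nat_cone S" "additive F" "\<And>y. y \<in> S \<Longrightarrow> F y \<ge> 0"
  shows "F x \<ge> 0"
  using assms(1)
  by induction (use assms(2,3) in \<open>auto simp: additive.zero additive.add\<close>)

lemma nat_cone_additive_eq:
  assumes "x \<in> nat_cone S" "additive F" "additive G" "\<And>y. y \<in> S \<Longrightarrow> F y = G y"
  shows "F x = G x"
  using assms(1)
  by induction (use assms(2-) in \<open>auto simp: additive.zero additive.add\<close>)

text \<open>The carrier is only an abelian group, so a reflection cannot be written as
  \<open>x - B x y * y\<close>; on roots \<open>B\<close> takes integer values from -2 to 2, and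
  \<open>s_root\<close> lists the outcomes. \<open>P\<close> is given by closure under addition, not
  by a functional.\<close>

locale simply_laced =
  fixes R P :: "'v::ab_group_add set"
    and B :: "'v \<Rightarrow> 'v \<Rightarrow> real"
    and I :: "'i set"
    and \<alpha> :: "'i \<Rightarrow> 'v"
    and s :: "'i \<Rightarrow> 'v \<Rightarrow> 'v"
  assumes finite_R: "finite R"
    and B_add: "B (x + y) z = B x z + B y z"
    and B_sym: "B x y = B y x"
    and B_self: "x \<in> R \<Longrightarrow> B x x = 2"
    and B_values: "x \<in> R \<Longrightarrow> y \<in> R \<Longrightarrow> x \<noteq> y \<Longrightarrow> x \<noteq> - y \<Longrightarrow> B x y \<in> {-1, 0, 1}"
    and diff_R: "x \<in> R \<Longrightarrow> y \<in> R \<Longrightarrow> B x y = 1 \<Longrightarrow> x - y \<in> R"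
    and R_eq: "P \<union> uminus ` P = R"
    and P_disj: "P \<inter> uminus ` P = {}"
    and P_add: "x \<in> P \<Longrightarrow> y \<in> P \<Longrightarrow> x + y \<in> R \<Longrightarrow> x + y \<in> P"
    and simple_enum: "bij_betw \<alpha> I {x \<in> P. \<not> (\<exists>y\<in>P. \<exists>z\<in>P. x = y + z)}"
    and s_add: "s i (x + y) = s i x + s i y"
    and s_invol: "i \<in> I \<Longrightarrow> s i (s i x) = x"
    and s_root: "i \<in> I \<Longrightarrow> x \<in> R \<Longrightarrow>
      s i x = (if B x (\<alpha> i) = 0 then x else if B x (\<alpha> i) = 1 then x - \<alpha> i
               else if B x (\<alpha> i) = -1 then x + \<alpha> i else - x)"
begin

lemma additive_B: "additive (\<lambda>x. B x y)" "additive (B x)"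
  by (unfold_locales; metis B_add B_sym)+

lemma B_simps [simp]:
  "B 0 y = 0" "B x 0 = 0" "B (- x) y = - B x y" "B x (- y) = - B x y"
  "B (x + z) y = B x y + B z y" "B x (y + z) = B x y + B x z"
  "B (x - z) y = B x y - B z y" "B x (y - z) = B x y - B x z"
  using additive.zero[OF additive_B(1)] additive.zero[OF additive_B(2)]
    additive.minus[OF additive_B(1)] additive.minus[OF additive_B(2)]
    additive.add[OF additive_B(1)] additive.add[OF additive_B(2)]
    additive.diff[OF additive_B(1)] additive.diff[OF additive_B(2)]
  by blast+

lemma B_sum: "B (sum g A) y = (\<Sum>a\<in>A. B (g a) y)" "B y (sum g A) = (\<Sum>a\<in>A. B y (g a))"
  using additive.sum[OF additive_B(1)] additive.sum[OF additive_B(2)] by auto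

lemma P_R: "x \<in> P \<Longrightarrow> x \<in> R" and uminus_P_R: "x \<in> P \<Longrightarrow> - x \<in> R"
  using R_eq by auto

lemma finite_P: "finite P"
  using finite_R R_eq by (metis finite_Un)

lemma R_cases: "x \<in> R \<Longrightarrow> x \<in> P \<or> - x \<in> P"
  using R_eq by auto

lemma uminus_R: "x \<in> R \<Longrightarrow> - x \<in> R"
  using R_cases P_R uminus_P_R by (metis minus_minus)

lemma not_both: "x \<in> P \<Longrightarrow> - x \<notin> P"
  using P_disj by (metis IntI empty_iff image_eqI minus_minus)

lemma B_two: "x \<in> R \<Longrightarrow> y \<in> R \<Longrightarrow> B x y = 2 \<longleftrightarrow> x = y"
  using B_values[of x y] B_self by fastforce

lemma B_minus_two: "x \<in> R \<Longrightarrow> y \<in> R \<Longrightarrow> B x y = -2 \<longleftrightarrow> x = - y"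
  using B_two[of x "- y"] uminus_R by auto

lemma B_cases: "x \<in> R \<Longrightarrow> y \<in> R \<Longrightarrow> B x y \<in> {-2, -1, 0, 1, 2}"
  using B_values[of x y] B_self by fastforce

lemma plus_R: "x \<in> R \<Longrightarrow> y \<in> R \<Longrightarrow> B x y = -1 \<Longrightarrow> x + y \<in> R"
  using diff_R[of x "- y"] uminus_R by simp

text \<open>Intended for roots: the last branch then covers the pairings 2 and -2, where
  \<open>x\<close> is \<open>y\<close> or \<open>- y\<close>.\<close>

definition reflect :: "'v \<Rightarrow> 'v \<Rightarrow> 'v" where
  "reflect y x = (if B x y = 0 then x else if B x y = 1 then x - y
                  else if B x y = -1 then x + y else - x)"

lemma s_reflect: "i \<in> I \<Longrightarrow> x \<in> R \<Longrightarrow> s i x = reflect (\<alpha> i) x"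
  by (simp add: s_root reflect_def)

lemma reflect_R: "x \<in> R \<Longrightarrow> y \<in> R \<Longrightarrow> reflect y x \<in> R"
  by (simp add: reflect_def diff_R plus_R uminus_R)

lemma B_reflect: "x \<in> R \<Longrightarrow> y \<in> R \<Longrightarrow> B (reflect y x) y = - B x y"
  by (simp add: reflect_def B_self)

lemma reflect_reflect: "x \<in> R \<Longrightarrow> y \<in> R \<Longrightarrow> reflect y (reflect y x) = x"
  by (simp add: reflect_def B_self)

text \<open>Twice the usual \<rho>. Pairing with it gives the strictly positive functional on
  \<open>P\<close> that the closure axioms do not provide directly.\<close>

definition r :: 'v where "r = \<Sum>P"

text \<open>The roots \<open>g\<close> with \<open>g\<close> and \<open>reflect b g\<close> both positive cancel in pairs.\<close>

lemma r_pos: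
  assumes b: "b \<in> P"
  shows "B r b > 0"
proof -
  let ?A = "{g \<in> P. reflect b g \<in> P}"
  have "(\<Sum>g\<in>?A. B g b) = (\<Sum>g\<in>?A. B (reflect b g) b)"
    by (rule sum.reindex_bij_witness[of _ "reflect b" "reflect b"])
      (use b in \<open>auto simp: reflect_reflect P_R\<close>)
  also have "\<dots> = - (\<Sum>g\<in>?A. B g b)"
    unfolding sum_negf[symmetric] using b by (intro sum.cong) (auto simp: B_reflect P_R)
  finally have A: "(\<Sum>g\<in>?A. B g b) = 0" by simp
  have pos: "B g b \<ge> 0" if "g \<in> P - ?A" for g
  proof (rule ccontr)
    assume "\<not> B g b \<ge> 0"
    then have "B g b = -1 \<or> B g b = -2" using B_cases[of g b] that b by (auto simp: P_R)
    moreover have "B g b \<noteq> -2" using B_minus_two[of g b] that b not_both by (auto simp: P_R)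
    ultimately have "B g b = -1" by simp
    with that b show False
      using P_add[of g b] plus_R[of g b] by (auto simp: reflect_def P_R)
  qed
  have "b \<in> P - ?A"
    using b not_both by (auto simp: reflect_def P_R B_self)
  then have "B b b \<le> (\<Sum>g\<in>P-?A. B g b)"
    using finite_P pos by (intro member_le_sum) auto
  moreover have "B r b = (\<Sum>g\<in>P-?A. B g b) + (\<Sum>g\<in>?A. B g b)"
    unfolding r_def B_sum using finite_P by (intro sum.subset_diff) auto
  ultimately show ?thesis using A b by (simp add: B_self P_R)
qed

lemma r_int: "x \<in> R \<Longrightarrow> \<exists>n::int. B r x = of_int n"
proof -
  assume x: "x \<in> R"
  have "B r x = (\<Sum>g\<in>P. B g x)" by (simp add: r_def B_sum)
  also have "\<dots> = (\<Sum>g\<in>P. of_int \<lfloor>B g x\<rfloor>)"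
    by (rule sum.cong) (use B_cases[OF P_R x] in force)+
  finally show ?thesis by (metis of_int_sum)
qed

abbreviation "simples \<equiv> \<alpha> ` I"

lemma Pi_eq: "simples = {x \<in> P. \<not> (\<exists>y\<in>P. \<exists>z\<in>P. x = y + z)}"
  using simple_enum by (simp add: bij_betw_def)

lemma \<alpha>_P: "i \<in> I \<Longrightarrow> \<alpha> i \<in> P"
  using Pi_eq by blast

lemma \<alpha>_R: "i \<in> I \<Longrightarrow> \<alpha> i \<in> R"
  using \<alpha>_P P_R by blast

lemma \<alpha>_inj: "i \<in> I \<Longrightarrow> j \<in> I \<Longrightarrow> \<alpha> i = \<alpha> j \<longleftrightarrow> i = j"
  using simple_enum by (auto simp: bij_betw_def inj_on_def)

lemma \<alpha>_indec: "i \<in> I \<Longrightarrow> x \<in> P \<Longrightarrow> y \<in> P \<Longrightarrow> \<alpha> i \<noteq> x + y"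
  using Pi_eq by blast

lemma finite_I: "finite I"
  using bij_betw_finite[OF simple_enum] finite_P by simp

text \<open>A positive root that is not simple splits into two positive ones, both with a smaller
  pairing with \<open>r\<close>. By \<open>r_pos\<close> and \<open>r_int\<close> these pairings are
  positive integers, so they serve as a measure before heights are available.\<close>

lemma P_induct [consumes 1, case_names simple plus]:
  assumes "x \<in> P" "\<And>i. i \<in> I \<Longrightarrow> Q (\<alpha> i)"
    "\<And>y z. y \<in> P \<Longrightarrow> z \<in> P \<Longrightarrow> y + z \<in> P \<Longrightarrow> Q y \<Longrightarrow> Q z \<Longrightarrow> Q (y + z)"
  shows "Q x"
  using assms(1)
proof (induction "nat \<lfloor>B r x\<rfloor>" arbitrary: x rule: less_induct)
  case less
  show ?case
  proof (cases "x \<in> simples")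
    case True
    then show ?thesis using assms(2) by blast
  next
    case False
    with less.prems obtain y z where yz: "y \<in> P" "z \<in> P" "x = y + z"
      using Pi_eq by blast
    obtain k n where "B r y = of_int k" "B r z = of_int n"
      using r_int yz P_R by metis
    with r_pos[OF yz(1)] r_pos[OF yz(2)] have
      "nat \<lfloor>B r y\<rfloor> < nat \<lfloor>B r x\<rfloor>" "nat \<lfloor>B r z\<rfloor> < nat \<lfloor>B r x\<rfloor>"
      using yz by auto
    with less yz assms(3) show ?thesis by blast
  qed
qed

lemma P_nat_cone: "x \<in> P \<Longrightarrow> x \<in> nat_cone simples"
  by (induction rule: P_induct) (auto intro: nat_cone_incl nat_cone_plus)

lemma additive_eq_on_R:
  assumes "x \<in> R" "additive F" "additive G" "\<And>i. i \<in> I \<Longrightarrow> F (\<alpha> i) = G (\<alpha> i)"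
  shows "F x = G x"
proof -
  have *: "F y = G y" if "y \<in> P" for y
    using nat_cone_additive_eq[OF P_nat_cone[OF that] assms(2,3)] assms(4) by auto
  show ?thesis
  proof (cases "x \<in> P")
    case False
    then have "F (- x) = G (- x)" using * R_cases assms(1) by blast
    then show ?thesis using assms(2,3) by (simp add: additive.minus)
  qed (use * in auto)
qed

text \<open>At pairing 1 the difference would be a root, and whichever of its two signs is positive
  would decompose one of the two simple roots.\<close>

lemma simple_obtuse:
  assumes "i \<in> I" "j \<in> I" "i \<noteq> j"
  shows "B (\<alpha> i) (\<alpha> j) = 0 \<or> B (\<alpha> i) (\<alpha> j) = -1"
proof (rule ccontr)
  assume *: "\<not> ?thesis"
  have "\<alpha> i \<noteq> \<alpha> j" using assms \<alpha>_inj by auto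
  moreover have "\<alpha> i \<noteq> - \<alpha> j" using assms \<alpha>_P not_both by metis
  ultimately have "B (\<alpha> i) (\<alpha> j) = 1"
    using B_values[of "\<alpha> i" "\<alpha> j"] \<alpha>_R assms * by auto
  then have "\<alpha> i - \<alpha> j \<in> P \<or> \<alpha> j - \<alpha> i \<in> P"
    using diff_R[of "\<alpha> i" "\<alpha> j"] \<alpha>_R assms R_cases[of "\<alpha> i - \<alpha> j"] by auto
  then show False
    using \<alpha>_indec[OF assms(1), of "\<alpha> i - \<alpha> j" "\<alpha> j"] \<alpha>_indec[OF assms(2), of "\<alpha> j - \<alpha> i" "\<alpha> i"]
      \<alpha>_P assms by auto
qed

lemma s_R: "i \<in> I \<Longrightarrow> x \<in> R \<Longrightarrow> s i x \<in> R"
  by (simp add: s_reflect reflect_R \<alpha>_R)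

lemma s_\<alpha>: "i \<in> I \<Longrightarrow> s i (\<alpha> i) = - \<alpha> i"
  by (simp add: s_root \<alpha>_R B_self)

text \<open>The critical case is pairing 1: if \<open>x - \<alpha> i\<close> were negative,
  \<open>\<alpha> i = (\<alpha> i - x) + x\<close> would decompose a simple root.\<close>

lemma s_P:
  assumes "i \<in> I" "x \<in> P" "x \<noteq> \<alpha> i"
  shows "s i x \<in> P"
proof -
  have R: "x \<in> R" "\<alpha> i \<in> R" using assms P_R \<alpha>_R by auto
  have "x \<noteq> - \<alpha> i" using assms \<alpha>_P not_both by (metis minus_minus)
  then have "B x (\<alpha> i) \<in> {-1, 0, 1}" using B_values R assms by blast
  moreover have "x - \<alpha> i \<in> P" if "B x (\<alpha> i) = 1"
  proof (rule ccontr)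
    assume "x - \<alpha> i \<notin> P"
    then have "\<alpha> i - x \<in> P" using R_cases[of "x - \<alpha> i"] diff_R[OF R that] by simp
    then show False using \<alpha>_indec[OF assms(1), of "\<alpha> i - x" x] assms by simp
  qed
  moreover have "x + \<alpha> i \<in> P" if "B x (\<alpha> i) = -1"
    using P_add plus_R R that assms \<alpha>_P by blast
  ultimately show ?thesis using assms R by (auto simp: s_root)
qed

lemma additive_s: "additive (s i)"
  by unfold_locales (rule s_add)

lemma s_minus: "s i (- x) = - s i x"
  by (rule additive.minus[OF additive_s])

section \<open>Words in the simple reflections\<close>

definition word :: "'i list \<Rightarrow> 'v \<Rightarrow> 'v" where
  "word ws = foldr (\<lambda>i f. s i \<circ> f) ws id"

lemma word_simps [simp]: "word [] x = x" "word (i # ws) x = s i (word ws x)"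
  by (simp_all add: word_def)

lemma word_append: "word (us @ vs) x = word us (word vs x)"
  by (induction us) auto

lemma additive_word: "additive (word ws)"
  by (induction ws) (auto simp: additive_def s_add)

lemma word_minus: "word ws (- x) = - word ws x"
  by (rule additive.minus[OF additive_word])

lemma word_R: "set ws \<subseteq> I \<Longrightarrow> x \<in> R \<Longrightarrow> word ws x \<in> R"
  by (induction ws) (auto simp: s_R)

lemma word_rev: "set ws \<subseteq> I \<Longrightarrow> word ws (word (rev ws) x) = x"
proof (induction ws arbitrary: x)
  case (Cons a ws)
  then show ?case by (simp add: word_append s_invol)
qed simp

lemma word_rev': "set ws \<subseteq> I \<Longrightarrow> word (rev ws) (word ws x) = x"
  using word_rev[of "rev ws"] by simp

lemma bij_word: "set ws \<subseteq> I \<Longrightarrow> bij (word ws)"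
  by (rule bij_betw_byWitness[where f' = "word (rev ws)"]) (auto simp: word_rev word_rev')

text \<open>The exchange argument: if \<open>word ws (\<alpha> i)\<close> is negative, the sign changes at some letter.\<close>

lemma exchange:
  assumes "set ws \<subseteq> I" "i \<in> I" "word ws (\<alpha> i) \<notin> P"
  shows "\<exists>us k vs. ws = us @ k # vs \<and> word vs (\<alpha> i) = \<alpha> k"
  using assms
proof (induction ws)
  case Nil
  then show ?case by (simp add: \<alpha>_P)
next
  case (Cons a ws)
  show ?case
  proof (cases "word ws (\<alpha> i) \<in> P")
    case True
    then have "word ws (\<alpha> i) = \<alpha> a" using s_P[of a "word ws (\<alpha> i)"] Cons.prems by auto
    then show ?thesis by (metis append_Nil)
  next
    case False
    with Cons obtain us k vs where "ws = us @ k # vs" "word vs (\<alpha> i) = \<alpha> k"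
      by auto
    then show ?thesis by (intro exI[of _ "a # us"]) auto
  qed
qed

lemma reflect_additive:
  assumes F: "additive F" and x: "x \<in> R" "y \<in> R" and "F x \<in> R" "F y \<in> R" "B (F x) (F y) = B x y"
  shows "F (reflect y x) = reflect (F y) (F x)"
  using assms by (simp add: reflect_def additive.add additive.diff additive.minus)

lemma B_reflect_reflect:
  assumes "x \<in> R" "y \<in> R" "z \<in> R"
  shows "B (reflect z x) (reflect z y) = B x y"
proof -
  have 1: "B z y = B y z" "B z x = B x z" "B z z = 2" using B_sym B_self assms by auto
  have c: "B u z = 0 \<or> B u z = 1 \<or> B u z = -1 \<or> u = z \<or> u = - z" if "u \<in> R" for u
    using B_values[OF that assms(3)] by blast
  from c[OF assms(1)] c[OF assms(2)] show ?thesis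
    by (elim disjE) (simp_all add: reflect_def 1)
qed

lemma B_s: "i \<in> I \<Longrightarrow> x \<in> R \<Longrightarrow> y \<in> R \<Longrightarrow> B (s i x) (s i y) = B x y"
  by (simp add: s_reflect B_reflect_reflect \<alpha>_R)

lemma B_word: "set ws \<subseteq> I \<Longrightarrow> x \<in> R \<Longrightarrow> y \<in> R \<Longrightarrow> B (word ws x) (word ws y) = B x y"
  by (induction ws) (auto simp: B_s word_R)

text \<open>The conjugation rule for reflections: a word carries the reflection in a root to the
  reflection in its image.\<close>

lemma word_conj:
  assumes "set ws \<subseteq> I" "i \<in> I" "k \<in> I" "word ws (\<alpha> i) = \<alpha> k" "x \<in> R"
  shows "word ws (s i x) = s k (word ws x)"
  using reflect_additive[OF additive_word, of x "\<alpha> i" ws] B_word[OF assms(1,5) \<alpha>_R[OF assms(2)]]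
    assms by (simp add: s_reflect \<alpha>_R word_R)

text \<open>If the last letter is \<open>i\<close>, the remaining word sends
  \<open>\<alpha> i\<close> to a negative root, so \<open>exchange\<close> yields a letter
  \<open>k\<close> such that the letters \<open>bs\<close> between it and \<open>i\<close> send
  \<open>\<alpha> i\<close> to \<open>\<alpha> k\<close>. By \<open>word_conj\<close>, both
  \<open>k\<close> and the final \<open>i\<close> can be struck out without changing the action on
  roots.\<close>

lemma word_eq_id:
  assumes "set ws \<subseteq> I" "word ws ` P \<subseteq> P" "x \<in> R"
  shows "word ws x = x"
  using assms
proof (induction "length ws" arbitrary: ws x rule: less_induct)
  case less
  show ?case
  proof (cases ws rule: rev_cases)
    case (snoc us i)
    then have i: "i \<in> I" and us: "set us \<subseteq> I" using less.prems by auto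
    have "word us (\<alpha> i) \<notin> P"
    proof
      assume "word us (\<alpha> i) \<in> P"
      moreover have "- word us (\<alpha> i) \<in> P"
        using less.prems(2) \<alpha>_P[OF i] snoc by (auto simp: word_append s_\<alpha>[OF i] word_minus)
      ultimately show False using not_both by blast
    qed
    then obtain as k bs where d: "us = as @ k # bs" "word bs (\<alpha> i) = \<alpha> k"
      using exchange[OF us i] by blast
    have sub: "set (as @ bs) \<subseteq> I" "set bs \<subseteq> I" "k \<in> I" using us d by auto
    have eq: "word ws y = word (as @ bs) y" if "y \<in> R" for y
    proof -
      have "word ws y = word as (s k (word bs (s i y)))"
        by (simp add: snoc d(1) word_append)
      also have "\<dots> = word (as @ bs) y"
        unfolding word_conj[OF sub(2) i sub(3) d(2) that] s_invol[OF sub(3)]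
        by (simp add: word_append)
      finally show ?thesis .
    qed
    have "word (as @ bs) ` P \<subseteq> P"
    proof (rule image_subsetI)
      fix y assume "y \<in> P"
      then have "word ws y \<in> P" using less.prems(2) by blast
      then show "word (as @ bs) y \<in> P" by (simp only: eq[OF P_R[OF \<open>y \<in> P\<close>]])
    qed
    moreover have "length (as @ bs) < length ws" using snoc d(1) by simp
    ultimately have "word (as @ bs) x = x"
      using less.hyps sub(1) less.prems(3) by blast
    then show ?thesis using eq[OF less.prems(3)] by (simp only:)
  qed simp
qed

section \<open>Connectedness of the Dynkin diagram\<close>

lemma P_support:
  assumes "x \<in> P" and IJK: "I = J \<union> K" and orth: "\<And>j k. j \<in> J \<Longrightarrow> k \<in> K \<Longrightarrow> B (\<alpha> j) (\<alpha> k) = 0"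
  shows "x \<in> nat_cone (\<alpha> ` J) \<or> x \<in> nat_cone (\<alpha> ` K)"
  using assms(1)
proof (induction rule: P_induct)
  case (simple i)
  then show ?case using IJK by (auto intro: nat_cone_incl)
next
  case (plus y z)
  have cross: "B u v = 0" if "u \<in> nat_cone (\<alpha> ` J)" "v \<in> nat_cone (\<alpha> ` K)" for u v
  proof -
    have 0: "additive (\<lambda>_::'v. 0::real)" by unfold_locales simp
    have "B (\<alpha> j) v = 0" if "j \<in> J" for j
      using nat_cone_additive_eq[OF \<open>v \<in> _\<close> additive_B(2) 0] orth that by auto
    then show ?thesis
      using nat_cone_additive_eq[OF \<open>u \<in> _\<close> additive_B(1) 0] by auto
  qed
  have R: "y \<in> R" "z \<in> R" "y + z \<in> R" using plus P_R by auto
  \<comment> \<open>Orthogonal summands would give \<open>y + z\<close> norm 4 instead of 2. So the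
    two summands lie over the same side.\<close>
  have "B y z \<noteq> 0" using B_self[OF R(1)] B_self[OF R(2)] B_self[OF R(3)] B_sym[of y z] by auto
  then show ?case using plus.IH cross nat_cone_plus B_sym by metis
qed

text \<open>If the diagram split, \<open>P_support\<close> would place \<psi> over one side. But
  \<psi> remains a sum of simple roots after subtracting any simple root, also one of the other
  side.\<close>

lemma connected_of_highest:
  assumes \<psi>: "\<psi> \<in> R" "\<And>k. k \<in> I \<Longrightarrow> \<psi> - \<alpha> k \<in> nat_cone simples"
    and J: "J \<subseteq> I" "J \<noteq> {}" "J \<noteq> I"
  shows "\<exists>i\<in>J. \<exists>j\<in>I-J. B (\<alpha> i) (\<alpha> j) = -1"
proof (rule ccontr)
  assume *: "\<not> ?thesis"
  have r0: "B r (\<alpha> i) > 0" if "i \<in> I" for i using r_pos \<alpha>_P that by blast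
  have orth: "B (\<alpha> j) (\<alpha> k) = 0" if "j \<in> J" "k \<in> I - J" for j k
    using simple_obtuse[of j k] * that J by auto
  have orth': "B (\<alpha> k) (\<alpha> j) = 0" if "j \<in> J" "k \<in> I - J" for j k
    using orth[OF that] B_sym by metis
  have no: "\<psi> \<notin> nat_cone (\<alpha> ` A)"
    if AK: "I = A \<union> K" "A \<inter> K = {}" "K \<noteq> {}" and o: "\<And>j k. j \<in> A \<Longrightarrow> k \<in> K \<Longrightarrow> B (\<alpha> j) (\<alpha> k) = 0"
    for A K
  proof
    assume \<psi>A: "\<psi> \<in> nat_cone (\<alpha> ` A)"
    obtain k where k: "k \<in> K" using AK by blast
    have "\<psi> - \<alpha> k \<in> nat_cone (\<alpha> ` A \<union> \<alpha> ` K)" using \<psi>(2)[of k] k AK by (simp add: image_Un)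
    then obtain u v where uv: "u \<in> nat_cone (\<alpha> ` A)" "v \<in> nat_cone (\<alpha> ` K)" "\<psi> - \<alpha> k = u + v"
      using nat_cone_Un by blast
    \<comment> \<open>As a member of the cone over \<open>K\<close>, \<open>x\<close> is orthogonal
      to the simple roots of \<open>A\<close>; as \<open>\<psi> - u\<close> it is orthogonal to
      those of \<open>K\<close>. Hence it is orthogonal to \<open>r\<close>, although it contains
      \<open>\<alpha> k\<close> and so pairs positively with \<open>r\<close>. This takes the place
      of uniqueness of coefficients.\<close>
    define x where "x = \<alpha> k + v"
    have x: "x \<in> nat_cone (\<alpha> ` K)" unfolding x_def using k uv by (intro nat_cone.add) auto
    have x': "x = \<psi> - u" using uv(3) by (simp add: x_def algebra_simps)
    have 0: "additive (\<lambda>_::'v. 0::real)" by unfold_locales simp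
    have "B x (\<alpha> i) = 0" if "i \<in> I" for i
    proof (cases "i \<in> A")
      case True
      then show ?thesis
        using nat_cone_additive_eq[OF x additive_B(1) 0, of "\<alpha> i"] o B_sym by fastforce
    next
      case False
      then have "i \<in> K" using that AK(1) by blast
      then have "B \<psi> (\<alpha> i) = 0" "B u (\<alpha> i) = 0"
        using nat_cone_additive_eq[OF \<psi>A additive_B(1) 0, of "\<alpha> i"]
          nat_cone_additive_eq[OF uv(1) additive_B(1) 0, of "\<alpha> i"] o by auto
      then show ?thesis by (simp add: x')
    qed
    then have "B x r = 0"
      unfolding r_def B_sum
      using nat_cone_additive_eq[OF P_nat_cone additive_B(2) 0, of _ x] by (intro sum.neutral) auto
    moreover have "B v r \<ge> 0"
      by (rule nat_cone_nonneg[OF uv(2) additive_B(1)]) (use r0 B_sym AK(1) in fastforce)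
    moreover have "B (\<alpha> k) r > 0" using r0 k AK(1) B_sym by (metis UnI2)
    ultimately show False by (simp add: x_def)
  qed
  \<comment> \<open>\<open>P_support\<close> speaks of positive roots. For negative \<psi>, both
    \<psi> and \<open>- \<alpha> k\<close> would pair negatively with \<open>r\<close>, while their
    sum is in the cone.\<close>
  have minus: "\<psi> \<in> P"
  proof (rule ccontr)
    assume "\<psi> \<notin> P"
    then have "- \<psi> \<in> P" using R_cases \<psi> by blast
    then have "B (- \<psi>) r > 0" using r_pos B_sym by metis
    obtain k where k: "k \<in> I" using J by blast
    have "B (\<psi> - \<alpha> k) r \<ge> 0"
      by (rule nat_cone_nonneg[OF \<psi>(2)[OF k] additive_B(1)]) (use r0 B_sym in fastforce)
    moreover have "B (\<alpha> k) r > 0" using r0 k B_sym by metis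
    ultimately show False using \<open>B (- \<psi>) r > 0\<close> by simp
  qed
  have IJ: "I = J \<union> (I - J)" "I = (I - J) \<union> J" using J by auto
  have 1: "\<psi> \<notin> nat_cone (\<alpha> ` J)"
    by (rule no[OF IJ(1)]) (use J orth in auto)
  have 2: "\<psi> \<notin> nat_cone (\<alpha> ` (I - J))"
    by (rule no[OF IJ(2)]) (use J orth' in auto)
  show False using P_support[OF minus IJ(1) orth] 1 2 by blast
qed

text \<open>If \<open>x\<close> had a positive entry, its positive part would pair nonpositively with every simple root,
  but positively with \<open>r\<close>.\<close>

lemma Gram_nondegenerate:
  fixes x :: "'i \<Rightarrow> real"
  assumes 0: "\<And>j. j \<in> I \<Longrightarrow> (\<Sum>i\<in>I. x i * B (\<alpha> i) (\<alpha> j)) = 0" and i: "i \<in> I"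
  shows "x i = 0"
proof -
  have main: "y i \<le> 0" if y: "\<And>j. j \<in> I \<Longrightarrow> (\<Sum>i\<in>I. y i * B (\<alpha> i) (\<alpha> j)) = 0" for y :: "'i \<Rightarrow> real"
  proof (rule ccontr)
    assume pos: "\<not> y i \<le> 0"
    define p where "p = (\<lambda>i. max 0 (y i))"
    define q where "q = (\<lambda>i. max 0 (- y i))"
    define F where "F = (\<lambda>v. \<Sum>i\<in>I. - p i * B (\<alpha> i) v)"
    have F: "additive F"
      by unfold_locales (simp add: F_def algebra_simps flip: sum.distrib)
    have "F (\<alpha> j) \<ge> 0" if j: "j \<in> I" for j
    proof (cases "y j \<le> 0")
      case True
      then show ?thesis
        unfolding F_def
        by (intro sum_nonneg) (use simple_obtuse[OF _ j] in \<open>force simp: p_def\<close>)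
    next
      case False
      \<comment> \<open>Adding the vanishing sum turns the coefficients \<open>- p\<close> into
        \<open>- q\<close>, whose entry at \<open>j\<close> is 0 because \<open>y j > 0\<close>.
        Only off-diagonal pairings are left, and these are not positive.\<close>
      have "F (\<alpha> j) = F (\<alpha> j) + (\<Sum>i\<in>I. y i * B (\<alpha> i) (\<alpha> j))" using y j by simp
      also have "\<dots> = (\<Sum>i\<in>I. - q i * B (\<alpha> i) (\<alpha> j))"
        unfolding F_def sum.distrib[symmetric]
        by (intro sum.cong) (auto simp: p_def q_def algebra_simps max_def)
      also have "\<dots> \<ge> 0"
        by (intro sum_nonneg) (use simple_obtuse[OF _ j] False in \<open>force simp: q_def\<close>)
      finally show ?thesis .
    qed
    then have "F g \<ge> 0" if "g \<in> P" for g
      using nat_cone_nonneg[OF P_nat_cone[OF that] F] by auto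
    then have "F r \<ge> 0" unfolding r_def additive.sum[OF F] by (intro sum_nonneg)
    then have le: "(\<Sum>i\<in>I. p i * B (\<alpha> i) r) \<le> 0" by (simp add: F_def sum_negf)
    have r0: "B (\<alpha> j) r > 0" if "j \<in> I" for j using r_pos \<alpha>_P that B_sym by metis
    have "p i * B (\<alpha> i) r \<le> (\<Sum>i\<in>I. p i * B (\<alpha> i) r)"
      by (rule member_le_sum) (use finite_I i less_imp_le[OF r0] in \<open>auto simp: p_def\<close>)
    moreover have "p i * B (\<alpha> i) r > 0" using pos r0[OF i] by (simp add: p_def)
    ultimately show False using le by simp
  qed
  from main[OF 0] main[of "\<lambda>i. - x i"] 0 show ?thesis by (force simp: sum_negf)
qed

end

section \<open>Bipartite diagrams and the two partial Coxeter elements\<close>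

locale bipartite = simply_laced +
  fixes L1 L2 :: "'b list"
  assumes I_split: "set L1 \<union> set L2 = I" "set L1 \<inter> set L2 = {}"
    and distinct: "distinct L1" "distinct L2"
    and orth1: "i \<in> set L1 \<Longrightarrow> j \<in> set L1 \<Longrightarrow> i \<noteq> j \<Longrightarrow> B (\<alpha> i) (\<alpha> j) = 0"
    and orth2: "i \<in> set L2 \<Longrightarrow> j \<in> set L2 \<Longrightarrow> i \<noteq> j \<Longrightarrow> B (\<alpha> i) (\<alpha> j) = 0"
    and I_ne: "I \<noteq> {}"
    and connected: "J \<subseteq> I \<Longrightarrow> J \<noteq> {} \<Longrightarrow> J \<noteq> I \<Longrightarrow> \<exists>i\<in>J. \<exists>j\<in>I-J. B (\<alpha> i) (\<alpha> j) = -1"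
begin

definition part :: "nat \<Rightarrow> 'b list" where "part n = (if even n then L1 else L2)"

abbreviation T :: "nat \<Rightarrow> 'a \<Rightarrow> 'a" where "T n \<equiv> word (part n)"

text \<open>The factors are \<open>T e\<close>, ..., \<open>T (e + k - 1)\<close>, the last acting
  first. So \<open>part (e + k)\<close> is the part whose turn comes next, and only the parity of
  \<open>e\<close> matters.\<close>

definition alt :: "nat \<Rightarrow> nat \<Rightarrow> 'a \<Rightarrow> 'a" where
  "alt e k = word (concat (map (\<lambda>t. part (e + t)) [0..<k]))"

lemma part_I: "set (part n) \<subseteq> I"
  using I_split by (auto simp: part_def)

lemma part_Suc: "set (part (Suc n)) = I - set (part n)"
  using I_split by (auto simp: part_def)

lemma alt_0 [simp]: "alt e 0 x = x"
  by (simp add: alt_def)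

lemma alt_Suc: "alt e (Suc k) x = alt e k (T (e + k) x)"
  by (simp add: alt_def word_append)

lemma alt_add: "alt e (j + k) x = alt e j (alt (e + j) k x)"
  by (induction k arbitrary: x) (simp_all add: alt_Suc add.assoc)

lemma alt_cong: "even e = even e' \<Longrightarrow> alt e k = alt e' k"
  by (simp add: alt_def part_def)

lemma alt_word: "\<exists>ws. set ws \<subseteq> I \<and> alt e k = word ws"
  unfolding alt_def using part_I by (intro exI conjI) auto

lemma additive_alt: "additive (alt e k)"
  by (simp add: alt_def additive_word)

lemma alt_minus: "alt e k (- x) = - alt e k x"
  by (simp add: alt_def word_minus)

lemma alt_R: "x \<in> R \<Longrightarrow> alt e k x \<in> R"
  using alt_word word_R by metis

lemma alt_inj: "alt e k x = alt e k y \<longleftrightarrow> x = y"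
  using alt_word[of e k] bij_word by (metis bij_def inj_eq)

text \<open>Each reflection fixes the simple roots of the other letters, so the letters act
  independently on \<open>\<alpha> i\<close>. General lists are allowed because the induction passes
  to tails of a part.\<close>

lemma word_orthogonal:
  assumes "set ws \<subseteq> I" "distinct ws" "i \<in> I"
    and "\<And>i j. i \<in> set ws \<Longrightarrow> j \<in> set ws \<Longrightarrow> i \<noteq> j \<Longrightarrow> B (\<alpha> i) (\<alpha> j) = 0"
  shows "word ws (\<alpha> i) = (if i \<in> set ws then - \<alpha> i
           else \<alpha> i + (\<Sum>k\<in>{k\<in>set ws. B (\<alpha> k) (\<alpha> i) = -1}. \<alpha> k))"
  using assms
proof (induction ws)
  case (Cons a ws)
  have a: "a \<in> I" "a \<notin> set ws" using Cons.prems by auto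
  have fixed: "s a (\<alpha> k) = \<alpha> k" if "k \<in> set ws" for k
  proof -
    have k: "k \<in> I" "k \<noteq> a" using Cons.prems(1) that a by auto
    then have "B (\<alpha> k) (\<alpha> a) = 0" using Cons.prems(4)[of k a] that by auto
    then show ?thesis using s_root[OF a(1) \<alpha>_R[OF k(1)]] by simp
  qed
  have IH: "word ws (\<alpha> i) = (if i \<in> set ws then - \<alpha> i
           else \<alpha> i + (\<Sum>k\<in>{k\<in>set ws. B (\<alpha> k) (\<alpha> i) = -1}. \<alpha> k))"
    using Cons by auto
  show ?case
  proof (cases "i \<in> set ws")
    case True
    then show ?thesis using IH fixed by (simp add: s_minus)
  next
    case False
    have "s a (\<Sum>k\<in>{k\<in>set ws. B (\<alpha> k) (\<alpha> i) = -1}. \<alpha> k) = (\<Sum>k\<in>{k\<in>set ws. B (\<alpha> k) (\<alpha> i) = -1}. \<alpha> k)"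
      unfolding additive.sum[OF additive_s] using fixed by (intro sum.cong) auto
    then have eq: "word (a # ws) (\<alpha> i) = s a (\<alpha> i) + (\<Sum>k\<in>{k\<in>set ws. B (\<alpha> k) (\<alpha> i) = -1}. \<alpha> k)"
      using IH False by (simp add: s_add)
    show ?thesis
    proof (cases "i = a")
      case True
      then have none: "{k\<in>set ws. B (\<alpha> k) (\<alpha> i) = -1} = {}"
        using Cons.prems(4)[of _ a] a(2) by fastforce
      show ?thesis using eq True a(1) unfolding none by (simp add: s_\<alpha>)
    next
      case ia: False
      show ?thesis
      proof (cases "B (\<alpha> a) (\<alpha> i) = -1")
        case True
        then have "{k\<in>set (a # ws). B (\<alpha> k) (\<alpha> i) = -1} = insert a {k\<in>set ws. B (\<alpha> k) (\<alpha> i) = -1}"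
          by auto
        then show ?thesis
          using eq ia a False True s_root[OF a(1) \<alpha>_R[OF assms(3)]] B_sym[of "\<alpha> i" "\<alpha> a"]
          by (simp add: add.assoc)
      next
        case nadj: False
        then have "B (\<alpha> a) (\<alpha> i) = 0" using simple_obtuse[OF a(1) assms(3)] ia by auto
        moreover from nadj have "{k\<in>set (a # ws). B (\<alpha> k) (\<alpha> i) = -1} = {k\<in>set ws. B (\<alpha> k) (\<alpha> i) = -1}"
          by auto
        ultimately show ?thesis
          using eq ia False s_root[OF a(1) \<alpha>_R[OF assms(3)]] B_sym[of "\<alpha> i" "\<alpha> a"] by simp
      qed
    qed
  qed
qed simp

lemma part_orth: "i \<in> set (part n) \<Longrightarrow> j \<in> set (part n) \<Longrightarrow> i \<noteq> j \<Longrightarrow> B (\<alpha> i) (\<alpha> j) = 0"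
  using orth1 orth2 by (auto simp: part_def split: if_splits)

lemma T_\<alpha>: "i \<in> set (part n) \<Longrightarrow> T n (\<alpha> i) = - \<alpha> i"
  using word_orthogonal[OF part_I, of n i] distinct subsetD[OF part_I, of i n] part_orth[of _ n]
  by (auto simp: part_def)

text \<open>No neighbour of \<open>i\<close> lies in its own part, so all of them lie in
  \<open>part n\<close> and the sum may run over \<open>I\<close>.\<close>

lemma T_\<alpha>': "i \<in> I - set (part n) \<Longrightarrow>
    T n (\<alpha> i) = \<alpha> i + (\<Sum>k\<in>{k\<in>I. B (\<alpha> k) (\<alpha> i) = -1}. \<alpha> k)"
proof -
  assume i: "i \<in> I - set (part n)"
  have "{k\<in>I. B (\<alpha> k) (\<alpha> i) = -1} = {k\<in>set (part n). B (\<alpha> k) (\<alpha> i) = -1}"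
    using part_orth[of _ "Suc n" i] part_Suc[of n] i part_I[of n] B_self[OF \<alpha>_R, of i] by force
  then show ?thesis
    using word_orthogonal[OF part_I, of n i] distinct part_orth[of _ n] i
    by (auto simp: part_def)
qed

lemma T_R: "x \<in> R \<Longrightarrow> T n x \<in> R"
  using word_R part_I by blast

text \<open>Instead of commuting the letters, the equation is checked on simple roots: the
  neighbours added by the first application are negated by the second, and cancel.\<close>

lemma T_invol:
  assumes "x \<in> R"
  shows "T n (T n x) = x"
proof (rule additive_eq_on_R[OF assms, of "\<lambda>x. T n (T n x)" "\<lambda>x. x"])
  show "additive (\<lambda>x. T n (T n x))" "additive (\<lambda>x::'a. x)"
    using additive.add[OF additive_word] by (auto simp: additive_def)
  show "T n (T n (\<alpha> i)) = \<alpha> i" if i: "i \<in> I" for i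
  proof (cases "i \<in> set (part n)")
    case True
    then show ?thesis by (simp add: T_\<alpha> word_minus)
  next
    case False
    have "T n (\<Sum>k\<in>{k\<in>I. B (\<alpha> k) (\<alpha> i) = -1}. \<alpha> k) = (\<Sum>k\<in>{k\<in>I. B (\<alpha> k) (\<alpha> i) = -1}. - \<alpha> k)"
      unfolding additive.sum[OF additive_word]
    proof (intro sum.cong refl T_\<alpha>)
      fix k assume k: "k \<in> {k\<in>I. B (\<alpha> k) (\<alpha> i) = -1}"
      show "k \<in> set (part n)"
        using part_orth[of k "Suc n" i] part_Suc[of n] k i False B_self[OF \<alpha>_R, of i] by force
    qed
    then show ?thesis
      using False i by (simp add: T_\<alpha>' additive.add[OF additive_word] sum_negf)
  qed
qed

lemma T_P:
  assumes "x \<in> P" "T n x \<notin> P"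
  obtains i where "i \<in> set (part n)" "x = \<alpha> i"
proof -
  \<comment> \<open>The second conjunct keeps \<open>s_P\<close> applicable at every letter. It
    persists because each reflection of the part maps the simple roots of the part to themselves up
    to sign.\<close>
  have "word ws x \<in> P \<and> word ws x \<notin> \<alpha> ` set (part n)"
    if "set ws \<subseteq> set (part n)" "x \<notin> \<alpha> ` set (part n)" for ws
    using that(1)
  proof (induction ws)
    case (Cons a ws)
    then have w: "word ws x \<in> P" "word ws x \<notin> \<alpha> ` set (part n)" by auto
    have a: "a \<in> I" "a \<in> set (part n)" using Cons.prems part_I by auto
    have "s a (word ws x) \<in> P" using s_P[OF a(1) w(1)] w(2) a(2) by blast
    moreover have "s a (word ws x) \<notin> \<alpha> ` set (part n)"
    proof
      assume "s a (word ws x) \<in> \<alpha> ` set (part n)"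
      then obtain j where j: "j \<in> set (part n)" "s a (word ws x) = \<alpha> j" by blast
      then have eq: "word ws x = s a (\<alpha> j)" using s_invol[OF a(1)] by metis
      have "j \<in> I" using j part_I by blast
      show False
      proof (cases "j = a")
        case True
        then have "word ws x = - \<alpha> a" using eq s_\<alpha>[OF a(1)] by simp
        then show False using w(1) not_both[OF \<alpha>_P[OF a(1)]] by simp
      next
        case False
        then have "s a (\<alpha> j) = \<alpha> j"
          using s_root[OF a(1) \<alpha>_R[OF \<open>j \<in> I\<close>]] part_orth[of j n a] j a by simp
        then show False using eq w(2) j by auto
      qed
    qed
    ultimately show ?case by simp
  qed (use assms that in auto)
  from this[of "part n"] assms show thesis using that by blast
qed

end

subsection \<open>Alternating products of the two partial Coxeter elements\<close>

text \<open>The two components are the factors by which an eigenfunctional changes along the alternating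
  products of \<open>\<tau>1\<close> and \<open>\<tau>2\<close>; the recursion is that of the Chebyshev polynomials.\<close>

primrec mesh :: "real \<Rightarrow> nat \<Rightarrow> real \<times> real" where
  "mesh \<mu> 0 = (1, 1)"
| "mesh \<mu> (Suc k) = (snd (mesh \<mu> k) + \<mu> * fst (mesh \<mu> k), - fst (mesh \<mu> k))"

context bipartite
begin

text \<open>\<open>F\<close> must be additive on the whole group, so it is built by pairing with the
  Perron vector instead of being prescribed on simple roots. The Gram matrix is 2 minus the
  adjacency matrix, hence \<open>F (\<alpha> j) = (2 - \<mu>) * c j\<close> is again an
  eigenvector.\<close>

lemma positive_eigenfunctional:
  obtains F :: "'a \<Rightarrow> real" and \<mu> where "additive F" "\<And>i. i \<in> I \<Longrightarrow> F (\<alpha> i) > 0"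
    "\<And>j. j \<in> I \<Longrightarrow> (\<Sum>i\<in>{i\<in>I. B (\<alpha> i) (\<alpha> j) = -1}. F (\<alpha> i)) = \<mu> * F (\<alpha> j)"
proof -
  define a where "a = (\<lambda>i j. if B (\<alpha> i) (\<alpha> j) = -1 then 1 else 0 :: real)"
  have "a i j = a j i" "a i j \<ge> 0" for i j
    using B_sym[of "\<alpha> i" "\<alpha> j"] by (auto simp: a_def)
  moreover have "\<exists>i\<in>J. \<exists>j\<in>I-J. a i j > 0" if "J \<subseteq> I" "J \<noteq> {}" "J \<noteq> I" for J
    using connected[OF that] by (auto simp: a_def)
  ultimately obtain c \<mu> where c: "\<And>i. i \<in> I \<Longrightarrow> c i > 0"
    and eig: "\<And>j. j \<in> I \<Longrightarrow> (\<Sum>i\<in>I. a i j * c i) = \<mu> * c j"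
    using Perron_eigenvector[OF finite_I I_ne, of a] by blast
  define F where "F = (\<lambda>v. \<Sum>i\<in>I. c i * B (\<alpha> i) v)"
  have F: "additive F"
    by unfold_locales (simp add: F_def algebra_simps flip: sum.distrib)
  have F\<alpha>: "F (\<alpha> j) = (2 - \<mu>) * c j" if j: "j \<in> I" for j
  proof -
    have "F (\<alpha> j) = (\<Sum>i\<in>I. (if i = j then 2 * c j else 0) - a i j * c i)"
      unfolding F_def
    proof (intro sum.cong refl)
      fix i assume "i \<in> I"
      then show "c i * B (\<alpha> i) (\<alpha> j) = (if i = j then 2 * c j else 0) - a i j * c i"
        using simple_obtuse[of i j] B_self[OF \<alpha>_R[OF j]] j by (auto simp: a_def)
    qed
    also have "\<dots> = 2 * c j - \<mu> * c j"
      using finite_I j eig by (simp add: sum_subtractf)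
    finally show ?thesis by (simp add: algebra_simps)
  qed
  \<comment> \<open>Otherwise \<open>F\<close> would be nonpositive on \<open>P\<close> and thus at
    \<open>r\<close>, yet \<open>F r\<close> is a positive combination of the pairings of the simple
    roots with \<open>r\<close>.\<close>
  have "\<mu> < 2"
  proof (rule ccontr)
    assume "\<not> \<mu> < 2"
    have F': "additive (\<lambda>v. - F v)"
      using F by (simp add: additive_def)
    have "- F g \<ge> 0" if "g \<in> P" for g
      by (rule nat_cone_nonneg[OF P_nat_cone[OF that] F'])
        (use F\<alpha> c \<open>\<not> \<mu> < 2\<close> in \<open>auto simp: mult_nonpos_nonneg less_imp_le\<close>)
    then have "F r \<le> 0" unfolding r_def additive.sum[OF F] by (intro sum_nonpos) force
    moreover have "F r > 0"
      unfolding F_def using finite_I I_ne c r_pos[OF \<alpha>_P] B_sym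
      by (intro sum_pos mult_pos_pos) metis+
    ultimately show False by simp
  qed
  show thesis
  proof (rule that[OF F])
    show "F (\<alpha> i) > 0" if "i \<in> I" for i using F\<alpha> c \<open>\<mu> < 2\<close> that by simp
    show "(\<Sum>i\<in>{i\<in>I. B (\<alpha> i) (\<alpha> j) = -1}. F (\<alpha> i)) = \<mu> * F (\<alpha> j)" if j: "j \<in> I" for j
    proof -
      have "(\<Sum>i\<in>{i\<in>I. B (\<alpha> i) (\<alpha> j) = -1}. F (\<alpha> i)) = (\<Sum>i\<in>I. (2 - \<mu>) * (a i j * c i))"
        using finite_I by (intro sum.mono_neutral_cong_left) (auto simp: a_def F\<alpha>)
      then show ?thesis using eig j F\<alpha> by (simp flip: sum_distrib_left)
    qed
  qed
qed

text \<open>After cancelling the common left factors, an equality with \<open>k < t\<close> would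
  express the negative root \<open>- \<alpha> i\<close> as a shorter alternating product that
  \<open>pos\<close> makes positive. Positivity is a premise because the lemma also serves to show
  that it fails for some length.\<close>

lemma alt_distinct:
  assumes pos: "\<And>e t i. t < m \<Longrightarrow> i \<in> set (part (e + t)) \<Longrightarrow> alt e t (\<alpha> i) \<in> P"
    and st: "k \<le> t" "t < m" and i: "i \<in> set (part (e + k))" and j: "j \<in> set (part (e + t))"
    and eq: "alt e k (\<alpha> i) = alt e t (\<alpha> j)"
  shows "k = t \<and> i = j"
proof -
  have I: "i \<in> I" "j \<in> I" using i j part_I by blast+
  have eq': "\<alpha> i = alt (e + k) (t - k) (\<alpha> j)"
    using eq alt_add[of e k "t - k" "\<alpha> j"] st alt_inj by simp
  show ?thesis
  proof (cases "k = t")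
    case True
    then show ?thesis using eq' \<alpha>_inj I by simp
  next
    case False
    then have d: "t - k = 1 + (t - Suc k)" using st by simp
    have "\<alpha> i = T (e + k) (alt (Suc (e + k)) (t - Suc k) (\<alpha> j))"
      using eq' unfolding d alt_add by (simp add: alt_Suc)
    then have "T (e + k) (\<alpha> i) = alt (Suc (e + k)) (t - Suc k) (\<alpha> j)"
      using T_invol alt_R \<alpha>_R I(2) by metis
    moreover have "alt (Suc (e + k)) (t - Suc k) (\<alpha> j) \<in> P"
      by (rule pos) (use st False j in auto)
    ultimately have "- \<alpha> i \<in> P" using T_\<alpha>[OF i] by simp
    then show ?thesis using \<alpha>_P[OF I(1)] not_both by blast
  qed
qed

lemma alternating_length:
  obtains m where "m > 0" "\<And>e t i. t < m \<Longrightarrow> i \<in> set (part (e + t)) \<Longrightarrow> alt e t (\<alpha> i) \<in> P"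
    "\<And>e x. x \<in> P \<Longrightarrow> - alt e m x \<in> P"
proof -
  obtain F :: "'a \<Rightarrow> real" and \<mu> :: real where F: "additive F" and F\<alpha>: "\<And>i. i \<in> I \<Longrightarrow> F (\<alpha> i) > 0"
    and eig: "\<And>j. j \<in> I \<Longrightarrow> (\<Sum>i\<in>{i\<in>I. B (\<alpha> i) (\<alpha> j) = -1}. F (\<alpha> i)) = \<mu> * F (\<alpha> j)"
    using positive_eigenfunctional by blast
  have FP: "F x > 0" if "x \<in> P" for x
    using that by (induction rule: P_induct) (auto simp: F\<alpha> additive.add[OF F])
  have Pos: "x \<in> P" if "x \<in> R" "F x > 0" for x
    using R_cases[OF that(1)] FP[of "- x"] that(2) by (auto simp: additive.minus[OF F])
  \<comment> \<open>The new factor acts directly on the simple root. It negates the roots of its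
    part and adds to any other root its neighbours, which all carry the first component of
    \<open>mesh\<close>; \<open>eig\<close> collapses their sum.\<close>
  have alt_F: "F (alt e k (\<alpha> i)) =
      (if i \<in> set (part (e + k)) then fst (mesh \<mu> k) else snd (mesh \<mu> k)) * F (\<alpha> i)"
    if "i \<in> I" for e k i
    using that
  proof (induction k arbitrary: i)
    case (Suc k)
    show ?case
    proof (cases "i \<in> set (part (e + k))")
      case True
      then have "F (alt e (Suc k) (\<alpha> i)) = - F (alt e k (\<alpha> i))"
        by (simp add: alt_Suc T_\<alpha> alt_minus additive.minus[OF F])
      then show ?thesis using True Suc part_Suc[of "e + k"] by simp
    next
      case False
      let ?N = "{k\<in>I. B (\<alpha> k) (\<alpha> i) = -1}"
      have N: "j \<in> set (part (e + k))" if "j \<in> ?N" for j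
        using part_orth[of j "Suc (e + k)" i] part_Suc[of "e + k"] that Suc.prems False B_self[OF \<alpha>_R, of i]
        by force
      have "F (alt e (Suc k) (\<alpha> i)) = F (alt e k (\<alpha> i)) + (\<Sum>j\<in>?N. F (alt e k (\<alpha> j)))"
        using False Suc.prems
        by (simp add: alt_Suc T_\<alpha>' additive.add[OF additive_alt] additive.sum[OF additive_alt]
            additive.add[OF F] additive.sum[OF F])
      also have "(\<Sum>j\<in>?N. F (alt e k (\<alpha> j))) = (\<Sum>j\<in>?N. fst (mesh \<mu> k) * F (\<alpha> j))"
        using N Suc.IH by (intro sum.cong) auto
      also have "\<dots> = fst (mesh \<mu> k) * (\<mu> * F (\<alpha> i))"
        using eig[OF Suc.prems] by (simp flip: sum_distrib_left)
      finally show ?thesis using False Suc part_Suc[of "e + k"] by (simp add: algebra_simps)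
    qed
  qed (simp add: mesh.simps)
  have pos_if: "alt e t (\<alpha> i) \<in> P" if "fst (mesh \<mu> t) > 0" "i \<in> set (part (e + t))" for e t i
  proof -
    have "i \<in> I" using that part_I by blast
    then show ?thesis
      using alt_F[OF \<open>i \<in> I\<close>, of e t] that F\<alpha> by (intro Pos alt_R \<alpha>_R) auto
  qed
  have "\<exists>k. \<not> fst (mesh \<mu> k) > 0"
  proof (rule ccontr)
    assume "\<not> ?thesis"
    then have pos: "alt e t (\<alpha> i) \<in> P" if "i \<in> set (part (e + t))" for e t i
      using pos_if that by blast
    obtain i where "i \<in> I" using I_ne by blast
    then obtain e where e: "i \<in> set (part e)" using part_Suc[of 0] by blast
    then have e2: "i \<in> set (part (e + 2 * k))" for k by (simp add: part_def)
    \<comment> \<open>Even lengths keep \<open>i\<close> in the part whose turn it is, so permanent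
      positivity would produce infinitely many roots.\<close>
    have "inj (\<lambda>k. alt e (2 * k) (\<alpha> i))"
    proof (rule linorder_injI)
      fix k l :: nat assume "k < l"
      show "alt e (2 * k) (\<alpha> i) \<noteq> alt e (2 * l) (\<alpha> i)"
      proof
        assume "alt e (2 * k) (\<alpha> i) = alt e (2 * l) (\<alpha> i)"
        from alt_distinct[of "Suc (2 * l)", OF pos _ _ e2 e2 this] \<open>k < l\<close> show False by simp
      qed
    qed
    moreover have "range (\<lambda>k. alt e (2 * k) (\<alpha> i)) \<subseteq> R" using alt_R \<alpha>_R \<open>i \<in> I\<close> by blast
    ultimately show False using finite_R finite_imageD infinite_UNIV_nat finite_subset by metis
  qed
  define m where "m = (LEAST k. \<not> fst (mesh \<mu> k) > 0)"
  have m: "\<not> fst (mesh \<mu> m) > 0" "\<And>t. t < m \<Longrightarrow> fst (mesh \<mu> t) > 0"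
    unfolding m_def using LeastI_ex[OF \<open>\<exists>k. _\<close>] not_less_Least by blast+
  have "m \<noteq> 0" using m(1) by (cases m) auto
  \<comment> \<open>The second component at \<open>m\<close> is minus the first component at
    \<open>m - 1\<close>, which is still positive. So after \<open>m\<close> factors
    \<open>F\<close> is nonpositive on the simple roots of both parts.\<close>
  then have snd: "snd (mesh \<mu> m) < 0" using m(2)[of "m - 1"] by (cases m) auto
  have neg: "- alt e m x \<in> P" if x: "x \<in> P" for e x
  proof -
    have "additive (\<lambda>x. - F (alt e m x))"
      by unfold_locales (simp add: additive.add[OF additive_alt] additive.add[OF F])
    then have "- F (alt e m x) \<ge> 0"
      by (rule nat_cone_nonneg[OF P_nat_cone[OF x]])
        (use alt_F m(1) snd F\<alpha> in \<open>auto simp: mult_nonpos_nonneg less_imp_le\<close>)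
    then have "alt e m x \<notin> P" using FP by force
    then show ?thesis using R_cases[OF alt_R[OF P_R[OF x]]] by blast
  qed
  show thesis
    by (rule that[of m]) (use \<open>m \<noteq> 0\<close> pos_if m(2) neg in auto)
qed

end

section \<open>Enumeration of the positive roots and orbits of the Coxeter element\<close>

locale bipartite_length = bipartite +
  fixes m :: nat
  assumes m_pos: "m > 0"
    and alt_pos: "t < m \<Longrightarrow> i \<in> set (part (e + t)) \<Longrightarrow> alt e t (\<alpha> i) \<in> P"
    and alt_neg: "x \<in> P \<Longrightarrow> - alt e m x \<in> P"
begin

lemma alt_eq_iff:
  assumes "k < m" "t < m" "i \<in> set (part (e + k))" "j \<in> set (part (e + t))"
  shows "alt e k (\<alpha> i) = alt e t (\<alpha> j) \<longleftrightarrow> k = t \<and> i = j"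
proof (cases "k \<le> t")
  case True
  from alt_distinct[OF alt_pos this assms(2,3,4)] show ?thesis by blast
next
  case False
  then have "t \<le> k" by simp
  from alt_distinct[OF alt_pos this assms(1,4,3)] show ?thesis by metis
qed

lemma P_eq: "P = (\<Union>t<m. (\<lambda>i. alt e t (\<alpha> i)) ` set (part (e + t)))"
proof (rule equalityI; rule subsetI)
  fix x assume x: "x \<in> P"
  \<comment> \<open>Apply the factors to the negative root \<open>y\<close> one at a time. At the
    first change of sign the result is a simple root of the acting part, by \<open>T_P\<close> and
    involutivity of the factor.\<close>
  have step: "\<exists>t<k. \<exists>i\<in>set (part (e + t)). x = alt e t (\<alpha> i)" if "x = alt e k y" "y \<in> R" "y \<notin> P" for k y
    using that
  proof (induction k arbitrary: y)
    case 0
    then show ?case using x by simp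
  next
    case (Suc k)
    have eq: "x = alt e k (T (e + k) y)" using Suc.prems(1) by (simp add: alt_Suc)
    show ?case
    proof (cases "T (e + k) y \<in> P")
      case True
      moreover have "T (e + k) (T (e + k) y) \<notin> P" using T_invol Suc.prems by simp
      ultimately obtain i where i: "i \<in> set (part (e + k))" "T (e + k) y = \<alpha> i" by (rule T_P)
      show ?thesis
        by (rule exI[of _ k], rule conjI[OF lessI], rule bexI[OF _ i(1)]) (simp only: eq i(2))
    next
      case False
      from Suc.IH[OF eq T_R[OF Suc.prems(2)] this] show ?thesis using less_SucI by metis
    qed
  qed
  \<comment> \<open>An injective self-map of a finite set is onto, so every positive root arises
    from a negative one by \<open>m\<close> factors.\<close>
  have "(\<lambda>x. - alt e m x) ` P = P"
    by (rule endo_inj_surj) (use finite_P alt_neg alt_inj in \<open>auto simp: inj_on_def\<close>)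
  then obtain y where "y \<in> P" "x = - alt e m y" using x by blast
  then have "x = alt e m (- y)" "- y \<in> R" "- y \<notin> P"
    using uminus_P_R not_both by (auto simp: alt_minus)
  from step[OF this] show "x \<in> (\<Union>t<m. (\<lambda>i. alt e t (\<alpha> i)) ` set (part (e + t)))" by blast
qed (use alt_pos in auto)

lemma card_part: "card (set (part n)) + card (set (part (Suc n))) = card I"
  using part_I[of n] card_mono[OF finite_I part_I[of n]]
  by (simp add: part_Suc card_Diff_subset)

text \<open>Enumerating once from each starting part brings the two parts together at every
  \<open>t\<close>, giving \<open>card I\<close> per length whatever their sizes and the parity of
  \<open>m\<close>.\<close>

lemma card_P: "2 * card P = m * card I"
proof -
  have "card P = (\<Sum>t<m. card (set (part (e + t))))" for e
  proof -
    have "card P = card (\<Union>t<m. (\<lambda>i. alt e t (\<alpha> i)) ` set (part (e + t)))" using P_eq by metis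
    also have "\<dots> = (\<Sum>t<m. card ((\<lambda>i. alt e t (\<alpha> i)) ` set (part (e + t))))"
      by (rule card_UN_disjoint) (use alt_eq_iff in auto)
    also have "\<dots> = (\<Sum>t<m. card (set (part (e + t))))"
      by (intro sum.cong refl card_image) (use alt_eq_iff in \<open>auto simp: inj_on_def\<close>)
    finally show ?thesis .
  qed
  from this[of 0] this[of 1] have "2 * card P = (\<Sum>t<m. card (set (part t)) + card (set (part (Suc t))))"
    by (simp add: sum.distrib)
  then show ?thesis by (simp add: card_part)
qed

lemma alt_period:
  assumes "x \<in> R"
  shows "alt e (2 * m) x = x"
proof -
  obtain ws where ws: "set ws \<subseteq> I" "alt e (2 * m) = word ws" using alt_word by blast
  have "alt e (2 * m) y \<in> P" if "y \<in> P" for y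
    using alt_neg[OF alt_neg[OF that, of "e + m"], of e] by (simp add: mult_2 alt_add alt_minus)
  then show ?thesis using word_eq_id[OF ws(1) _ assms] ws(2) by auto
qed

text \<open>\<open>T 0\<close> acts first, as \<tau>1 does in \<sigma>. Powers are thus alternating
  products with leftmost factor \<open>T 1\<close>, and powers of the inverse those with leftmost
  factor \<open>T 0\<close>.\<close>

definition cox :: "'a \<Rightarrow> 'a" where "cox x = T 1 (T 0 x)"

lemma bij_cox: "bij cox"
  using bij_comp[OF bij_word[OF part_I[of 0]] bij_word[OF part_I[of 1]]] by (simp add: cox_def[abs_def] comp_def)

lemma cox_R: "x \<in> R \<Longrightarrow> cox x \<in> R"
  by (simp add: cox_def T_R)

lemma inv_cox: "x \<in> R \<Longrightarrow> inv cox x = T 0 (T 1 x)"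
  by (intro inv_f_eq) (use bij_cox in \<open>auto simp: bij_def cox_def T_invol T_R\<close>)

lemma cox_pow: "x \<in> R \<Longrightarrow> (cox ^^ k) x = alt 1 (2 * k) x"
proof (induction k arbitrary: x)
  case (Suc k)
  have "(cox ^^ Suc k) x = (cox ^^ k) (cox x)" by (simp add: funpow_swap1)
  also have "\<dots> = alt 1 (2 * k) (cox x)" using Suc cox_R by blast
  also have "\<dots> = alt 1 (2 * Suc k) x" by (simp add: alt_Suc cox_def part_def)
  finally show ?case .
qed simp

lemma inv_cox_pow: "x \<in> R \<Longrightarrow> (inv cox ^^ k) x = alt 0 (2 * k) x"
proof (induction k arbitrary: x)
  case (Suc k)
  have "(inv cox ^^ Suc k) x = (inv cox ^^ k) (T 0 (T 1 x))"
    by (simp add: funpow_swap1 inv_cox[OF Suc.prems])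
  also have "\<dots> = alt 0 (2 * k) (T 0 (T 1 x))" using Suc T_R by blast
  also have "\<dots> = alt 0 (2 * Suc k) x" by (simp add: alt_Suc part_def)
  finally show ?case .
qed simp

lemma cox_order: "x \<in> R \<Longrightarrow> (cox ^^ m) x = x"
  by (simp add: cox_pow alt_period)

lemma cox_order_minimal:
  assumes "n > 0" "\<And>x. x \<in> R \<Longrightarrow> (cox ^^ n) x = x"
  shows "m \<le> n"
proof (rule ccontr)
  assume n: "\<not> m \<le> n"
  \<comment> \<open>Odd \<open>e\<close> concerns the power of \<open>cox\<close>, even
    \<open>e\<close> that of its inverse; \<open>i\<close> may lie in either part.\<close>
  have fixed: "alt e (2 * n) x = x" if x: "x \<in> R" for e x
  proof (cases "even e")
    case True
    have "inj (cox ^^ n)" using bij_cox by (simp add: bij_def inj_fn)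
    moreover have "(cox ^^ n) ((inv cox ^^ n) x) = x"
      using bij_cox by (simp add: fn_o_inv_fn_is_id[unfolded fun_eq_iff comp_def] )
    ultimately show ?thesis
      using assms(2)[OF x] inv_cox_pow[OF x] alt_cong[of e 0] True by (metis even_zero injD)
  next
    case False
    then show ?thesis using alt_cong[of e 1] cox_pow[OF x] assms(2)[OF x] by simp
  qed
  obtain i where i: "i \<in> I" using I_ne by blast
  then obtain e where e: "i \<in> set (part e)" using part_Suc[of 0] by blast
  then have e2: "i \<in> set (part (e + 2 * n))" by (simp add: part_def)
  have eq: "alt e (2 * n) (\<alpha> i) = \<alpha> i" using fixed \<alpha>_R i by blast
  show False
  \<comment> \<open>Below \<open>m\<close>, the return of \<open>\<alpha> i\<close> contradicts
    distinctness of the enumerated roots. Otherwise m <= 2n < 2m, and the image is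
    \<open>alt e m\<close> of a positive root, hence negative.\<close>
  proof (cases "2 * n < m")
    case True
    then show ?thesis
      using alt_eq_iff[of 0 "2 * n" i e i] m_pos e e2 eq assms(1) by simp
  next
    case False
    have "alt (e + m) (2 * n - m) (\<alpha> i) \<in> P"
      by (rule alt_pos) (use n False e2 in auto)
    then have "- alt e (m + (2 * n - m)) (\<alpha> i) \<in> P" unfolding alt_add by (rule alt_neg)
    then show False using False eq \<alpha>_P[OF i] not_both by simp
  qed
qed

definition \<beta> :: "'b \<Rightarrow> 'a" where "\<beta> i = (if i \<in> set L1 then \<alpha> i else - \<alpha> i)"

lemma \<beta>_R: "i \<in> I \<Longrightarrow> \<beta> i \<in> R"
  by (simp add: \<beta>_def \<alpha>_R uminus_R)

text \<open>Powers of the inverse have the leftmost factor used to enumerate \<open>P\<close>.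
  Finite order rewrites the forward power \<open>n\<close> as the inverse power
  \<open>n * (m - 1)\<close>.\<close>

lemma orbit_eq:
  assumes x: "x \<in> R"
  shows "orbit_of (cyclic_group cox) x = (\<lambda>k. alt 0 (2 * k) x) ` {..<m}"
proof -
  have inv_m: "(inv cox ^^ m) x = x" using inv_cox_pow[OF x] alt_period[OF x] by simp
  have "(inv cox ^^ n) x \<in> (\<lambda>k. alt 0 (2 * k) x) ` {..<m}" for n
    using funpow_mod_eq[OF inv_m, of n] m_pos inv_cox_pow[OF x] by (metis image_eqI lessThan_iff mod_less_divisor)
  moreover have "(cox ^^ n) x = (inv cox ^^ (n * (m - 1))) x" for n
  proof -
    have "x = (inv cox ^^ (n * m)) x" using funpow_mod_eq[OF inv_m, of "n * m"] by simp
    also have "n * m = n + n * (m - 1)" using m_pos by (cases m) auto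
    finally have "(cox ^^ n) x = (cox ^^ n) ((inv cox ^^ n) ((inv cox ^^ (n * (m - 1))) x))"
      by (simp add: funpow_add)
    then show ?thesis
      using bij_cox by (simp add: fn_o_inv_fn_is_id[unfolded fun_eq_iff comp_def])
  qed
  moreover have "orbit_of (cyclic_group cox) x
      = range (\<lambda>n. (cox ^^ n) x) \<union> range (\<lambda>n. (inv cox ^^ n) x)"
    by (simp add: orbit_of_def cyclic_group_def image_Un image_image)
  ultimately show ?thesis
    unfolding inv_cox_pow[OF x] by auto
qed

lemma positive_orbit:
  assumes i: "i \<in> I"
  shows "P \<inter> orbit_of (cyclic_group cox) (\<beta> i) = (\<lambda>t. alt 0 t (\<alpha> i)) ` {t. t < m \<and> i \<in> set (part t)}"
proof -
  \<comment> \<open>The rightmost factor negates \<open>\<alpha> i\<close>; this absorbs the minus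
    sign of \<open>\<beta> i\<close> and turns even lengths into odd ones.\<close>
  have shift: "alt 0 (2 * Suc k) (\<beta> i) = alt 0 (Suc (2 * k)) (\<alpha> i)" if "i \<notin> set L1" for k
  proof -
    have "i \<in> set (part (Suc (2 * k)))" using that i I_split by (auto simp: part_def)
    then show ?thesis
      using that T_\<alpha>[of i "Suc (2 * k)"] by (simp add: alt_Suc \<beta>_def word_minus)
  qed
  have neg: "alt 0 t (\<alpha> i) \<notin> P" if "m \<le> t" "t < 2 * m" "i \<in> set (part t)" for t
  proof -
    have "alt (0 + m) (t - m) (\<alpha> i) \<in> P" by (rule alt_pos) (use that in auto)
    then have "- alt 0 (m + (t - m)) (\<alpha> i) \<in> P" unfolding alt_add by (rule alt_neg)
    then show ?thesis using that not_both by force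
  qed
  show ?thesis
  proof (rule equalityI; rule subsetI)
    fix x assume x: "x \<in> P \<inter> orbit_of (cyclic_group cox) (\<beta> i)"
    then obtain k where k: "k < m" "x = alt 0 (2 * k) (\<beta> i)" using orbit_eq[OF \<beta>_R[OF i]] by auto
    obtain t where "t < 2 * m" "x = alt 0 t (\<alpha> i)" "i \<in> set (part t)"
    proof (cases "i \<in> set L1")
      case True
      then show ?thesis using that[of "2 * k"] k by (simp add: \<beta>_def part_def)
    next
      case False
      \<comment> \<open>For \<open>k = 0\<close> the element is \<open>- \<alpha> i\<close>, which
        is not positive.\<close>
      then obtain l where "k = Suc l"
        using k x \<alpha>_P[OF i] not_both by (cases k) (auto simp: \<beta>_def)
      then show ?thesis
        using that[of "Suc (2 * l)"] shift[OF False] k i I_split False by (auto simp: part_def)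
    qed
    then show "x \<in> (\<lambda>t. alt 0 t (\<alpha> i)) ` {t. t < m \<and> i \<in> set (part t)}"
      using neg x by (metis (mono_tags, lifting) Int_iff image_eqI mem_Collect_eq not_le)
  next
    fix x assume "x \<in> (\<lambda>t. alt 0 t (\<alpha> i)) ` {t. t < m \<and> i \<in> set (part t)}"
    then obtain t where t: "x = alt 0 t (\<alpha> i)" "t < m" "i \<in> set (part t)" by blast
    have "x \<in> P" using alt_pos[of t i 0] t by simp
    moreover have "\<exists>k. x = (inv cox ^^ k) (\<beta> i)"
    proof (cases "i \<in> set L1")
      case True
      then have "even t" using t(3) I_split by (auto simp: part_def split: if_splits)
      then show ?thesis using True t(1) inv_cox_pow[OF \<beta>_R[OF i]] by (auto simp: \<beta>_def elim!: evenE)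
    next
      case False
      then have "odd t" using t(3) by (auto simp: part_def split: if_splits)
      then obtain l where "t = Suc (2 * l)" by (auto elim!: oddE)
      then show ?thesis using shift[OF False, of l] t(1) inv_cox_pow[OF \<beta>_R[OF i], of "Suc l"] by metis
    qed
    ultimately show "x \<in> P \<inter> orbit_of (cyclic_group cox) (\<beta> i)"
      by (auto simp: orbit_of_def cyclic_group_def)
  qed
qed

lemma P_eq_Union_orbits: "P = (\<Union>i\<in>I. P \<inter> orbit_of (cyclic_group cox) (\<beta> i))"
proof -
  have "P = (\<Union>t<m. (\<lambda>i. alt 0 t (\<alpha> i)) ` set (part t))" using P_eq[of 0] by simp
  also have "\<dots> = (\<Union>i\<in>I. (\<lambda>t. alt 0 t (\<alpha> i)) ` {t. t < m \<and> i \<in> set (part t)})"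
    using part_I by blast
  also have "\<dots> = (\<Union>i\<in>I. P \<inter> orbit_of (cyclic_group cox) (\<beta> i))"
    by (intro SUP_cong refl) (simp add: positive_orbit)
  finally show ?thesis .
qed

lemma disjoint_positive_orbits:
  "disjoint_family_on (\<lambda>i. P \<inter> orbit_of (cyclic_group cox) (\<beta> i)) I"
  unfolding disjoint_family_on_def using alt_eq_iff[where e = 0]
  by (auto simp: positive_orbit simp del: Int_iff)

lemma card_positive_orbit:
  assumes "even m" "i \<in> I"
  shows "2 * card (P \<inter> orbit_of (cyclic_group cox) (\<beta> i)) = m"
proof -
  obtain n where n: "m = 2 * n" using assms(1) by blast
  have "card (P \<inter> orbit_of (cyclic_group cox) (\<beta> i)) = card {t. t < m \<and> i \<in> set (part t)}"
    unfolding positive_orbit[OF assms(2)]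
    by (intro card_image) (use alt_eq_iff[where e = 0] in \<open>auto simp: inj_on_def\<close>)
  also have "\<dots> = card {..<n}"
  proof (cases "i \<in> set L1")
    case True
    then have "{t. t < m \<and> i \<in> set (part t)} = (\<lambda>k. 2 * k) ` {..<n}"
      using I_split by (auto simp: part_def n image_iff elim!: evenE)
    then show ?thesis by (simp add: card_image inj_on_def)
  next
    case False
    then have "{t. t < m \<and> i \<in> set (part t)} = (\<lambda>k. Suc (2 * k)) ` {..<n}"
      using I_split assms(2) by (auto simp: part_def n image_iff elim!: oddE)
    then show ?thesis by (simp add: card_image inj_on_def)
  qed
  finally show ?thesis using n by simp
qed

end

subsection \<open>The root systems of types A, D and E as norm-2 vectors of lattices\<close>

text \<open>\<open>dot\<close> sums over the common support, which varies with the vectors; a fixed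
  range gives bilinearity on all functions.\<close>

definition ip :: "nat \<Rightarrow> (nat \<Rightarrow> real) \<Rightarrow> (nat \<Rightarrow> real) \<Rightarrow> real" where
  "ip N x y = (\<Sum>k<N. x k * y k)"

definition simply_laced_model :: "nat \<Rightarrow> (nat \<Rightarrow> real) set \<Rightarrow> bool" where
  "simply_laced_model N \<Phi> \<longleftrightarrow> finite \<Phi> \<and>
     (\<forall>x\<in>\<Phi>. (\<forall>k\<ge>N. x k = 0) \<and> ip N x x = 2 \<and> - x \<in> \<Phi>) \<and>
     (\<forall>x\<in>\<Phi>. \<forall>y\<in>\<Phi>. ip N x y \<in> \<int> \<and> (ip N x y = 1 \<longrightarrow> x - y \<in> \<Phi>))"

lemma ip_sym: "ip N x y = ip N y x"
  by (simp add: ip_def mult.commute)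

lemma ip_add: "ip N (x + y) z = ip N x z + ip N y z"
  by (simp add: ip_def distrib_right sum.distrib)

lemma ip_minus: "ip N (- x) y = - ip N x y"
  by (simp add: ip_def sum_negf)

lemma ip_diff: "ip N (x - y) z = ip N x z - ip N y z"
  by (simp add: ip_def left_diff_distrib sum_subtractf)

lemma ip_nonneg: "ip N x x \<ge> 0"
  by (simp add: ip_def sum_nonneg)

lemma ip_eq_0: "ip N x x = 0 \<Longrightarrow> (\<And>k. k \<ge> N \<Longrightarrow> x k = 0) \<Longrightarrow> x = 0"
  by (auto simp: ip_def fun_eq_iff sum_nonneg_eq_0_iff) (metis lessThan_iff not_le)

lemma dot_eq_ip:
  assumes "\<And>k. k \<ge> N \<Longrightarrow> x k = 0"
  shows "dot x y = ip N x y"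
  unfolding dot_def ip_def
  by (rule sum.mono_neutral_left) (use assms in \<open>auto simp: not_le[symmetric]\<close>)

text \<open>Strict Cauchy-Schwarz: \<open>x - y\<close> and \<open>x + y\<close> are nonzero, so
  their norms 4 - 2c and 4 + 2c, with c = \<open>ip N x y\<close>, are positive.\<close>

lemma model_values:
  assumes M: "simply_laced_model N \<Phi>" and xy: "x \<in> \<Phi>" "y \<in> \<Phi>" and ne: "x \<noteq> y" "x \<noteq> - y"
  shows "ip N x y \<in> {-1, 0, 1}"
proof -
  have 2: "ip N x x = 2" "ip N y y = 2" and supp: "\<And>k. k \<ge> N \<Longrightarrow> x k = 0 \<and> y k = 0"
    and int: "ip N x y \<in> \<int>"
    using M xy by (auto simp: simply_laced_model_def)
  have "ip N (x - y) (x - y) \<noteq> 0" using ip_eq_0[of N "x - y"] supp ne by auto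
  then have "ip N (x - y) (x - y) > 0" using ip_nonneg[of N "x - y"] by linarith
  then have "ip N x y < 2"
    using 2 by (simp add: ip_diff ip_sym[of N _ "x - y"] ip_sym[of N y x])
  have "ip N (x + y) (x + y) \<noteq> 0"
    using ip_eq_0[of N "x + y"] supp ne by (auto simp: eq_neg_iff_add_eq_0)
  then have "ip N (x + y) (x + y) > 0" using ip_nonneg[of N "x + y"] by linarith
  then have "ip N x y > -2"
    using 2 by (simp add: ip_add ip_sym[of N _ "x + y"] ip_sym[of N y x])
  obtain n where n: "ip N x y = of_int n" using int by (auto elim: Ints_cases)
  with \<open>ip N x y < 2\<close> \<open>ip N x y > -2\<close> have "-2 < n" "n < 2" by auto
  then have "n = -1 \<or> n = 0 \<or> n = 1" by arith
  then show ?thesis using n by auto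
qed

text \<open>Norm-2 vectors with inner product 1 have a difference of norm 2 + 2 - 2. Half-integral
  coordinates with squares at most 2 leave only finitely many vectors.\<close>

lemma lattice_model:
  assumes diff: "\<And>x y. x \<in> \<Lambda> \<Longrightarrow> y \<in> \<Lambda> \<Longrightarrow> x - y \<in> \<Lambda>"
    and supp: "\<And>x k. x \<in> \<Lambda> \<Longrightarrow> k \<ge> N \<Longrightarrow> x k = 0"
    and half: "\<And>x k. x \<in> \<Lambda> \<Longrightarrow> 2 * x k \<in> \<int>"
    and int: "\<And>x y. x \<in> \<Lambda> \<Longrightarrow> y \<in> \<Lambda> \<Longrightarrow> ip N x y \<in> \<int>"
  shows "simply_laced_model N {v \<in> \<Lambda>. ip N v v = 2}"
proof -
  let ?D = "(\<lambda>n. of_int n / 2) ` {-4..4::int} :: real set"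
  have "{v \<in> \<Lambda>. ip N v v = 2} \<subseteq> {f. \<forall>k. (k \<in> {..<N} \<longrightarrow> f k \<in> ?D) \<and> (k \<notin> {..<N} \<longrightarrow> f k = 0)}"
  proof clarsimp
    fix v k assume v: "v \<in> \<Lambda>" "ip N v v = 2"
    have "v k \<in> ?D" if k: "k < N"
    proof -
      obtain n where n: "2 * v k = of_int n" using half[OF v(1)] by (auto elim: Ints_cases)
      have "v k * v k \<le> ip N v v" unfolding ip_def by (rule member_le_sum) (use k in auto)
      then have "(2 * v k) * (2 * v k) \<le> 8" using v by simp
      then have "n * n \<le> 8" unfolding n by (metis of_int_le_numeral_iff of_int_mult)
      have "\<bar>n\<bar> \<le> 4"
      proof (rule ccontr)
        assume "\<not> \<bar>n\<bar> \<le> 4"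
        then have "5 * 5 \<le> \<bar>n\<bar> * \<bar>n\<bar>" by (intro mult_mono) auto
        then show False using \<open>n * n \<le> 8\<close> by simp
      qed
      then show ?thesis using n by (intro image_eqI[of _ _ n]) auto
    qed
    then show "(k < N \<longrightarrow> v k \<in> ?D) \<and> (\<not> k < N \<longrightarrow> v k = 0)" using supp v by auto
  qed
  moreover have "finite {f. \<forall>k. (k \<in> {..<N} \<longrightarrow> f k \<in> ?D) \<and> (k \<notin> {..<N} \<longrightarrow> f k = 0)}"
    by (rule finite_set_of_finite_funs) auto
  ultimately have "finite {v \<in> \<Lambda>. ip N v v = 2}" by (rule finite_subset)
  moreover have "- x \<in> \<Lambda>" if "x \<in> \<Lambda>" for x
    using diff[OF diff[OF that that] that] by simp
  moreover have "ip N (x - y) (x - y) = 2" if "ip N x x = 2" "ip N y y = 2" "ip N x y = 1" for x y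
    using that by (simp add: ip_diff ip_sym[of N _ "x - y"] ip_sym[of N y x])
  moreover have "ip N (- x) (- x) = ip N x x" for x by (simp add: ip_minus ip_sym[of N _ "- x"])
  ultimately show ?thesis
    unfolding simply_laced_model_def using diff supp int by auto
qed

definition Z_lattice :: "nat \<Rightarrow> (nat \<Rightarrow> real) set" where
  "Z_lattice N = {v. (\<forall>k. v k \<in> \<int>) \<and> (\<forall>k\<ge>N. v k = 0)}"

text \<open>Norm 2 with integer entries forces two entries of absolute value 1 and zeros elsewhere,
  and so an even coordinate sum; hence Z^N can stand in for the lattice D_N.\<close>

lemma D_roots_eq: "D_roots N = {v \<in> Z_lattice N. ip N v v = 2}"
proof (rule equalityI; rule subsetI)
  fix v assume "v \<in> D_roots N"
  then obtain a b i j where v: "v = (\<lambda>k. a * unit_vec i k + b * unit_vec j k)"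
    and ab: "a = 1 \<or> a = -1" "b = 1 \<or> b = -1" and ij: "i < N" "j < N" "i \<noteq> j"
    by (auto simp: D_roots_def)
  have "ip N v v = (\<Sum>k<N. (if k = i then 1 else 0) + (if k = j then 1 else 0))"
    unfolding ip_def v by (intro sum.cong) (use ab ij in \<open>auto simp: unit_vec_def\<close>)
  also have "\<dots> = 2" using ij by (simp add: sum.distrib)
  finally show "v \<in> {v \<in> Z_lattice N. ip N v v = 2}"
    using ab ij by (auto simp: Z_lattice_def v unit_vec_def)
next
  fix v assume v: "v \<in> {v \<in> Z_lattice N. ip N v v = 2}"
  then have Z: "\<And>k. v k \<in> \<int>" and supp: "\<And>k. k \<ge> N \<Longrightarrow> v k = 0" and 2: "(\<Sum>k<N. v k * v k) = 2"
    by (auto simp: Z_lattice_def ip_def)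
  have unit: "v k = 1 \<or> v k = -1" if "v k \<noteq> 0" "v k * v k \<le> 2" for k
  proof -
    obtain n where n: "v k = of_int n" using Z by (auto elim: Ints_cases)
    have "n * n \<le> 2" using that unfolding n by (metis of_int_le_numeral_iff of_int_mult)
    have "\<bar>n\<bar> \<le> 1"
    proof (rule ccontr)
      assume "\<not> \<bar>n\<bar> \<le> 1"
      then have "2 * 2 \<le> \<bar>n\<bar> * \<bar>n\<bar>" by (intro mult_mono) auto
      then show False using \<open>n * n \<le> 2\<close> by simp
    qed
    moreover have "n \<noteq> 0" using that n by simp
    ultimately have "n = 1 \<or> n = -1" by arith
    then show ?thesis using n by auto
  qed
  have le: "v k * v k \<le> 2" if "k < N" for k
    unfolding 2[symmetric] by (rule member_le_sum) (use that in auto)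
  obtain i where i: "i < N" "v i \<noteq> 0"
    using 2 by (metis (no_types, lifting) lessThan_iff mult_zero_left sum.neutral zero_neq_numeral)
  then have vi: "v i = 1 \<or> v i = -1" using unit le by blast
  have 1: "(\<Sum>k\<in>{..<N} - {i}. v k * v k) = 1"
    using 2 i vi by (subst (asm) sum.remove[of _ i]) auto
  then obtain j where j: "j < N" "j \<noteq> i" "v j \<noteq> 0"
    by (metis (no_types, lifting) Diff_iff insertI1 lessThan_iff mult_zero_left sum.neutral zero_neq_one)
  then have vj: "v j = 1 \<or> v j = -1" using unit le by blast
  have "(\<Sum>k\<in>{..<N} - {i} - {j}. v k * v k) = 0"
    using 1 j vj by (subst (asm) sum.remove[of _ j]) auto
  then have "\<And>k. k \<in> {..<N} - {i} - {j} \<Longrightarrow> v k = 0"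
    by (subst (asm) sum_nonneg_eq_0_iff) auto
  then have "v k = v i * unit_vec i k + v j * unit_vec j k" for k
    using supp[of k] j(2) by (cases "k < N") (auto simp: unit_vec_def)
  then have "v = (\<lambda>k. v i * unit_vec i k + v j * unit_vec j k)" by blast
  then show "v \<in> D_roots N" using i j vi vj unfolding D_roots_def by blast
qed

lemma Z_lattice_ip: "x \<in> Z_lattice N \<Longrightarrow> y \<in> Z_lattice N \<Longrightarrow> ip M x y \<in> \<int>"
  by (auto simp: Z_lattice_def ip_def intro!: Ints_sum)

lemma model_D: "simply_laced_model N (D_roots N)"
  unfolding D_roots_eq
  by (rule lattice_model) (auto simp: Z_lattice_ip, auto simp: Z_lattice_def)

lemma A_roots_eq: "A_roots l = {v \<in> {v \<in> Z_lattice (Suc l). (\<Sum>k\<le>l. v k) = 0}. ip (Suc l) v v = 2}"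
proof -
  have sum: "(\<Sum>k\<le>l. a * unit_vec i k + b * unit_vec j k) = a + b" if "i \<le> l" "j \<le> l" for a b i j
    using that by (simp add: unit_vec_def sum.distrib if_distrib[of "(*) _"] cong: if_cong)
  have "A_roots l = {v \<in> D_roots (Suc l). (\<Sum>k\<le>l. v k) = 0}"
  proof (rule equalityI; rule subsetI)
    fix v assume "v \<in> A_roots l"
    then obtain i j where v: "v = unit_vec i - unit_vec j" and ij: "i \<le> l" "j \<le> l" "i \<noteq> j"
      by (auto simp: A_roots_def)
    have v': "v = (\<lambda>k. 1 * unit_vec i k + (-1) * unit_vec j k)" by (simp add: v fun_eq_iff)
    have "v \<in> D_roots (Suc l)"
      unfolding D_roots_def v' using ij by (intro CollectI exI conjI) (rule refl, auto)
    then show "v \<in> {v \<in> D_roots (Suc l). (\<Sum>k\<le>l. v k) = 0}"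
      using sum[OF ij(1,2), of 1 "-1"] by (simp add: v')
  next
    fix v assume v: "v \<in> {v \<in> D_roots (Suc l). (\<Sum>k\<le>l. v k) = 0}"
    then obtain a b i j where v': "v = (\<lambda>k. a * unit_vec i k + b * unit_vec j k)"
      and ab: "a = 1 \<or> a = -1" "b = 1 \<or> b = -1" and ij: "i \<le> l" "j \<le> l" "i \<noteq> j"
      by (auto simp: D_roots_def less_Suc_eq_le)
    have "a + b = 0" using v sum[OF ij(1,2), of a b] by (simp add: v')
    then have "v = unit_vec i - unit_vec j \<or> v = unit_vec j - unit_vec i"
      using ab by (auto simp: v' fun_eq_iff)
    then show "v \<in> A_roots l" using ij unfolding A_roots_def by blast
  qed
  then show ?thesis unfolding D_roots_eq by blast
qed

lemma model_A: "simply_laced_model (Suc l) (A_roots l)"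
  unfolding A_roots_eq
  by (rule lattice_model) (auto simp: Z_lattice_ip, auto simp: Z_lattice_def sum_subtractf)

text \<open>The lattice D_8 together with its translate by the vector with all entries 1/2.\<close>

definition E8_lattice :: "(nat \<Rightarrow> real) set" where
  "E8_lattice = {v. (\<forall>k\<ge>8. v k = 0) \<and> ((\<forall>k<8. v k \<in> \<int>) \<or> (\<forall>k<8. v k - 1/2 \<in> \<int>)) \<and>
     (\<Sum>k<8. v k) / 2 \<in> \<int>}"

lemma E8_lattice_diff:
  assumes "x \<in> E8_lattice" "y \<in> E8_lattice"
  shows "x - y \<in> E8_lattice"
proof -
  have "(\<Sum>k<8. x k) / 2 - (\<Sum>k<8. y k) / 2 \<in> \<int>" using assms by (auto simp: E8_lattice_def)
  moreover have "x k - y k \<in> \<int>" if "x k \<in> \<int>" "y k \<in> \<int>" for k using that by simp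
  moreover have "x k - y k - 1/2 \<in> \<int>" if "x k - 1/2 \<in> \<int>" "y k \<in> \<int>" for k
    using Ints_diff[OF that] by (simp add: algebra_simps)
  moreover have "x k - y k - 1/2 \<in> \<int>" if "x k \<in> \<int>" "y k - 1/2 \<in> \<int>" for k
  proof -
    have "x k - (y k - 1/2) - 1 \<in> \<int>" by (rule Ints_diff[OF Ints_diff[OF that] Ints_1])
    moreover have "x k - (y k - 1/2) - 1 = x k - y k - 1/2" by simp
    ultimately show ?thesis by (simp only:)
  qed
  moreover have "x k - y k \<in> \<int>" if "x k - 1/2 \<in> \<int>" "y k - 1/2 \<in> \<int>" for k
    using Ints_diff[OF that] by simp
  ultimately show ?thesis
    using assms by (auto simp: E8_lattice_def sum_subtractf diff_divide_distrib)
qed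

lemma E8_lattice_ip:
  assumes "x \<in> E8_lattice" "y \<in> E8_lattice"
  shows "ip 8 x y \<in> \<int>"
proof -
  have *: "ip 8 x y \<in> \<int>"
    if x: "x \<in> E8_lattice" "\<forall>k<8. x k \<in> \<int>" and y: "y \<in> E8_lattice" for x y
  proof (cases "\<forall>k<8. y k \<in> \<int>")
    case True
    then show ?thesis using x by (auto simp: ip_def intro!: Ints_sum)
  next
    case False
    then have y': "\<forall>k<8. y k - 1/2 \<in> \<int>" using y by (auto simp: E8_lattice_def)
    \<comment> \<open>Shifting \<open>y\<close> into the integers costs half the coordinate sum of
      \<open>x\<close>, an integer by the evenness condition.\<close>
    have "ip 8 x y = (\<Sum>k<8. x k * (y k - 1/2)) + (\<Sum>k<8. x k) / 2"
      by (simp add: ip_def algebra_simps sum_subtractf sum_divide_distrib)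
    also have "\<dots> \<in> \<int>" using x y' by (intro Ints_add Ints_sum Ints_mult) (auto simp: E8_lattice_def)
    finally show ?thesis .
  qed
  show ?thesis
  proof (cases "(\<forall>k<8. x k \<in> \<int>) \<or> (\<forall>k<8. y k \<in> \<int>)")
    case True
    then show ?thesis using *[OF assms(1) _ assms(2)] *[OF assms(2) _ assms(1)] ip_sym by metis
  next
    case False
    then have h: "\<forall>k<8. x k - 1/2 \<in> \<int>" "\<forall>k<8. y k - 1/2 \<in> \<int>"
      using assms by (auto simp: E8_lattice_def)
    \<comment> \<open>The constant 2 is eight times 1/4.\<close>
    have "ip 8 x y = (\<Sum>k<8. (x k - 1/2) * (y k - 1/2)) + (\<Sum>k<8. x k) / 2 + (\<Sum>k<8. y k) / 2 - 2"
      by (simp add: ip_def algebra_simps sum_subtractf sum.distrib sum_divide_distrib)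
    also have "\<dots> \<in> \<int>"
    proof (intro Ints_add Ints_diff Ints_sum)
      show "(\<Sum>k<8. x k) / 2 \<in> \<int>" "(\<Sum>k<8. y k) / 2 \<in> \<int>" using assms by (auto simp: E8_lattice_def)
    qed (use h in \<open>auto intro: Ints_mult\<close>)
    finally show ?thesis .
  qed
qed

lemma E8_lattice_half: "x \<in> E8_lattice \<Longrightarrow> 2 * x k \<in> \<int>"
proof (cases "x k \<in> \<int>")
  case False
  assume x: "x \<in> E8_lattice"
  then have "x k - 1/2 \<in> \<int>" using False by (cases "k < 8") (auto simp: E8_lattice_def)
  then have "2 * (x k - 1/2) + 1 \<in> \<int>" by (intro Ints_add Ints_mult) auto
  then show ?thesis by (simp add: algebra_simps)
qed auto

definition half_spin :: "(nat \<Rightarrow> real) set" where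
  "half_spin = {v. (\<forall>k<8. v k \<in> {1/2, -1/2}) \<and> (\<forall>k\<ge>8. v k = 0) \<and> even (card {k. k < 8 \<and> v k < 0})}"

text \<open>Each minus sign lowers the maximal coordinate sum 4 by one; this turns the parity
  condition on signs into the evenness condition of the lattice.\<close>

lemma half_sum:
  assumes "\<forall>k<8. v k \<in> {1/2, -1/2 :: real}"
  shows "(\<Sum>k<8. v k) / 2 = 2 - real (card {k. k < (8::nat) \<and> v k < 0}) / 2"
proof -
  have "(\<Sum>k<8. v k) = (\<Sum>k<8. 1/2 - (if k \<in> {k. k < 8 \<and> v k < 0} then 1 else 0))"
    by (intro sum.cong) (use assms in auto)
  also have "\<dots> = 4 - real (card ({..<8} \<inter> {k. k < 8 \<and> v k < 0}))"
    unfolding sum_subtractf by (subst sum.If_cases) auto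
  also have "{..<8} \<inter> {k. k < 8 \<and> v k < 0} = {k. k < (8::nat) \<and> v k < 0}" by auto
  finally show ?thesis by simp
qed

lemma half_int_iff: "real n / 2 \<in> \<int> \<longleftrightarrow> even n"
proof
  assume "real n / 2 \<in> \<int>"
  then obtain z where "real n / 2 = of_int z" by (auto elim: Ints_cases)
  then have "real_of_int (int n) = real_of_int (2 * z)" by simp
  then have "int n = 2 * z" by (simp only: of_int_eq_iff)
  then have "even (int n)" by simp
  then show "even n" by simp
qed (auto elim!: evenE)

lemma E8_roots_eq: "E8_roots = {v \<in> E8_lattice. ip 8 v v = 2}"
proof -
  have H: "half_spin = {v \<in> E8_lattice. ip 8 v v = 2 \<and> (\<forall>k<8. v k - 1/2 \<in> \<int>)}"
  proof (rule equalityI; rule subsetI)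
    fix v assume v: "v \<in> half_spin"
    then have h: "\<forall>k<8. v k \<in> {1/2, -1/2}" by (simp add: half_spin_def)
    have "ip 8 v v = (\<Sum>k<8::nat. 1/4)" unfolding ip_def
    proof (intro sum.cong refl)
      fix k :: nat assume "k \<in> {..<8}"
      then have "v k = 1/2 \<or> v k = -1/2" using h by blast
      then show "v k * v k = 1/4" by (elim disjE) (simp_all del: eq_divide_eq_numeral1)
    qed
    then have "ip 8 v v = 2" by simp
    moreover have "v k - 1/2 \<in> \<int>" if "k < 8" for k
    proof -
      have "v k = 1/2 \<or> v k = -1/2" using h that by blast
      then have "v k - 1/2 = 0 \<or> v k - 1/2 = -1" by linarith
      then show ?thesis by (elim disjE) (simp_all only: Ints_0 Ints_minus Ints_1)
    qed
    moreover have "(\<Sum>k<8. v k) / 2 \<in> \<int>"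
      using v unfolding half_sum[OF h] by (intro Ints_diff) (auto simp: half_int_iff half_spin_def)
    ultimately show "v \<in> {v \<in> E8_lattice. ip 8 v v = 2 \<and> (\<forall>k<8. v k - 1/2 \<in> \<int>)}"
      using v by (auto simp: E8_lattice_def half_spin_def)
  next
    fix v assume v: "v \<in> {v \<in> E8_lattice. ip 8 v v = 2 \<and> (\<forall>k<8. v k - 1/2 \<in> \<int>)}"
    \<comment> \<open>A coordinate n + 1/2 has square 1/4 + n(n + 1), at least 1/4. Eight such
      squares sum to 2 only if each equals 1/4.\<close>
    have ge: "v k * v k - 1/4 \<ge> 0" if k: "k < 8" for k
    proof -
      obtain n where "v k - 1/2 = of_int n" using v k by (auto elim: Ints_cases)
      then have n: "v k = of_int n + 1/2" by simp
      have "n * (n + 1) \<ge> 0" by (cases "n \<ge> 0") (auto simp: mult_nonpos_nonpos)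
      then have "real_of_int (n * (n + 1)) \<ge> 0" by (simp only: of_int_0_le_iff)
      then show ?thesis unfolding n by (simp add: algebra_simps)
    qed
    have "(\<Sum>k<8. v k * v k - 1/4) = 0" using v by (simp add: ip_def sum_subtractf)
    then have sq: "v k * v k - 1/4 = 0" if "k < 8" for k
      using ge that by (subst (asm) sum_nonneg_eq_0_iff) auto
    have h: "\<forall>k<8. v k \<in> {1/2, -1/2}"
    proof (intro allI impI)
      fix k :: nat assume "k < 8"
      then have "(v k - 1/2) * (v k + 1/2) = 0" using sq[of k] by (simp add: algebra_simps)
      then show "v k \<in> {1/2, -1/2}" by (auto simp: add_eq_0_iff2)
    qed
    have "(\<Sum>k<8. v k) / 2 \<in> \<int>" using v by (simp add: E8_lattice_def)
    then have "2 - (\<Sum>k<8. v k) / 2 \<in> \<int>" by (intro Ints_diff) auto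
    then have "even (card {k. k < (8::nat) \<and> v k < 0})"
      unfolding half_sum[OF h] by (simp add: half_int_iff)
    then show "v \<in> half_spin" using h v by (auto simp: half_spin_def E8_lattice_def)
  qed
  have D: "D_roots 8 = {v \<in> E8_lattice. ip 8 v v = 2 \<and> (\<forall>k<8. v k \<in> \<int>)}"
  proof (rule equalityI; rule subsetI)
    fix v assume v: "v \<in> D_roots 8"
    then obtain a b i j where v': "v = (\<lambda>k. a * unit_vec i k + b * unit_vec j k)"
      and ab: "a = 1 \<or> a = -1" "b = 1 \<or> b = -1" and ij: "i < 8" "j < 8" "i \<noteq> j"
      by (auto simp: D_roots_def)
    have "(\<Sum>k<8. v k) = a + b"
      using ij unfolding v'
      by (simp add: unit_vec_def sum.distrib if_distrib[of "(*) _"] cong: if_cong)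
    then have "(\<Sum>k<8. v k) / 2 \<in> \<int>" using ab by auto
    then show "v \<in> {v \<in> E8_lattice. ip 8 v v = 2 \<and> (\<forall>k<8. v k \<in> \<int>)}"
      using v by (auto simp: D_roots_eq E8_lattice_def Z_lattice_def)
  next
    fix v assume v: "v \<in> {v \<in> E8_lattice. ip 8 v v = 2 \<and> (\<forall>k<8. v k \<in> \<int>)}"
    then have "v k \<in> \<int>" for k by (cases "k < 8") (auto simp: E8_lattice_def)
    then show "v \<in> D_roots 8" using v by (auto simp: D_roots_eq E8_lattice_def Z_lattice_def)
  qed
  show ?thesis unfolding E8_roots_def half_spin_def[symmetric] D H by (auto simp: E8_lattice_def)
qed

lemma model_E8: "simply_laced_model 8 E8_roots"
  unfolding E8_roots_eq
  by (rule lattice_model) (auto intro: E8_lattice_diff E8_lattice_ip E8_lattice_half, auto simp: E8_lattice_def)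

lemma model_E7: "simply_laced_model 8 E7_roots"
proof -
  let ?L = "{v \<in> E8_lattice. v 6 = - v 7}"
  have "E7_roots = {v \<in> ?L. ip 8 v v = 2}"
    by (auto simp: E7_roots_def E8_roots_eq)
  moreover have "simply_laced_model 8 {v \<in> ?L. ip 8 v v = 2}"
    by (rule lattice_model)
      (auto intro: E8_lattice_diff E8_lattice_ip E8_lattice_half, auto simp: E8_lattice_def)
  ultimately show ?thesis by (simp only:)
qed

lemma model_E6: "simply_laced_model 8 E6_roots"
proof -
  let ?L = "{v \<in> E8_lattice. v 5 = v 6 \<and> v 6 = - v 7}"
  have "E6_roots = {v \<in> ?L. ip 8 v v = 2}"
    by (auto simp: E6_roots_def E8_roots_eq)
  moreover have "simply_laced_model 8 {v \<in> ?L. ip 8 v v = 2}"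
    by (rule lattice_model)
      (auto intro: E8_lattice_diff E8_lattice_ip E8_lattice_half, auto simp: E8_lattice_def)
  ultimately show ?thesis by (simp only:)
qed


section \<open>Numbers of roots\<close>

lemma card_D_roots: "card (D_roots l) = 2 * (l * (l - 1))"
proof -
  let ?v = "\<lambda>(i::nat) (j::nat) (a::real) (b::real) k. a * unit_vec i k + b * unit_vec j k"
  \<comment> \<open>Four sign choices for each pair \<open>j < i\<close>; the support of a root
    recovers the pair, so these families are disjoint.\<close>
  define S where "S = (\<lambda>i j. (\<lambda>(a, b). ?v i j a b) ` ({1, -1} \<times> {1, -1}))"
  have at: "?v i j a b i = a" "?v i j a b j = b" if "i \<noteq> j" for i j a b
    using that by (auto simp: unit_vec_def)
  have inj: "a = a' \<and> b = b'" if "i \<noteq> j" "?v i j a b = ?v i j a' b'" for i j a b a' b'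
    using at[OF that(1)] that(2) by metis
  have card4: "card (S i j) = 4" if "j < i" for i j
  proof -
    have "inj_on (\<lambda>(a, b). ?v i j a b) ({1, -1} \<times> {1, -1})"
    proof (rule inj_onI)
      fix p q :: "real \<times> real"
      assume "(\<lambda>(a, b). ?v i j a b) p = (\<lambda>(a, b). ?v i j a b) q"
      then have "?v i j (fst p) (snd p) = ?v i j (fst q) (snd q)" by (simp only: case_prod_beta)
      from inj[OF _ this] that show "p = q" by (simp add: prod_eq_iff)
    qed
    then show ?thesis unfolding S_def by (simp add: card_image card_cartesian_product)
  qed
  have supp: "{k. x k \<noteq> 0} = {i, j}" if "x \<in> S i j" "j < i" for x i j
    using that by (auto simp: S_def unit_vec_def split: if_splits)
  have eq: "D_roots l = (\<Union>p\<in>(SIGMA i:{..<l}. {..<i}). S (fst p) (snd p))"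
  proof (rule equalityI; rule subsetI)
    fix x assume "x \<in> D_roots l"
    then obtain a b i j where x: "x = ?v i j a b" and ab: "a = 1 \<or> a = -1" "b = 1 \<or> b = -1"
      and ij: "i < l" "j < l" "i \<noteq> j"
      unfolding D_roots_def by blast
    have x': "x = ?v j i b a" unfolding x by (simp add: add.commute)
    show "x \<in> (\<Union>p\<in>(SIGMA i:{..<l}. {..<i}). S (fst p) (snd p))"
    proof (cases "j < i")
      case True
      then show ?thesis using ij ab by (intro UN_I[of "(i, j)"]) (auto simp: x S_def)
    next
      case False
      then show ?thesis using ij ab by (intro UN_I[of "(j, i)"]) (auto simp: x' S_def)
    qed
  next
    fix x assume "x \<in> (\<Union>p\<in>(SIGMA i:{..<l}. {..<i}). S (fst p) (snd p))"
    then obtain i j where ij: "i < l" "j < i" and x: "x \<in> S i j" by auto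
    from x obtain p where p: "p \<in> {1, -1} \<times> {1, -1}" "x = (\<lambda>(a, b). ?v i j a b) p"
      unfolding S_def by (rule imageE)
    then have "x = ?v i j (fst p) (snd p)" "fst p \<in> {1, -1}" "snd p \<in> {1, -1}"
      by (simp_all only: case_prod_beta mem_Times_iff)
    moreover have "j < l" "i \<noteq> j" using ij by auto
    ultimately show "x \<in> D_roots l" unfolding D_roots_def using ij(1) by blast
  qed
  have "card (D_roots l) = (\<Sum>p\<in>(SIGMA i:{..<l}. {..<i}). card (S (fst p) (snd p)))"
    unfolding eq
  proof (rule card_UN_disjoint)
    show "\<forall>p\<in>(SIGMA i:{..<l}. {..<i}). \<forall>q\<in>(SIGMA i:{..<l}. {..<i}). p \<noteq> q \<longrightarrow>
        S (fst p) (snd p) \<inter> S (fst q) (snd q) = {}"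
    proof (intro ballI impI)
      fix p q assume pq: "p \<in> (SIGMA i:{..<l}. {..<i})" "q \<in> (SIGMA i:{..<l}. {..<i})" "p \<noteq> q"
      then have lt: "snd p < fst p" "snd q < fst q" by auto
      show "S (fst p) (snd p) \<inter> S (fst q) (snd q) = {}"
      proof (rule ccontr)
        assume "\<not> ?thesis"
        then obtain x where "x \<in> S (fst p) (snd p)" "x \<in> S (fst q) (snd q)" by blast
        then have "{fst p, snd p} = {fst q, snd q}" using supp lt by metis
        then show False using lt pq(3) by (auto simp: doubleton_eq_iff prod_eq_iff)
      qed
    qed
  qed (auto simp: S_def)
  also have "\<dots> = (\<Sum>p\<in>(SIGMA i:{..<l}. {..<i}). 4)"
    by (intro sum.cong refl card4) auto
  also have "\<dots> = 4 * (\<Sum>i<l. i)" by (simp add: card_SigmaI)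
  also have "\<dots> = 2 * (l * (l - 1))"
    by (induction l) (auto simp: algebra_simps)
  finally show ?thesis .
qed

text \<open>Seven signs are free and the eighth is forced by parity.\<close>

lemma card_half_spin: "card half_spin = 128"
proof -
  let ?f = "\<lambda>v::nat \<Rightarrow> real. {k. k < 7 \<and> v k < 0}"
  let ?g = "\<lambda>S k. if k < 7 then if k \<in> S then -1/2 else 1/2
                else if k = 7 then if even (card S) then 1/2 else -1/2 else (0::real)"
  have eight: "k < 8 \<longleftrightarrow> k < 7 \<or> k = 7" for k :: nat by auto
  have neg: "card {k. k < 8 \<and> v k < 0} = card (?f v) + (if v 7 < 0 then 1 else 0)"
    for v :: "nat \<Rightarrow> real"
  proof -
    have "{k. k < 8 \<and> v k < 0} = (if v 7 < 0 then insert 7 (?f v) else ?f v)"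
      using eight by auto
    then show ?thesis by simp
  qed
  have "bij_betw ?f half_spin (Pow {..<7})"
  proof (rule bij_betw_byWitness[where f' = ?g])
    show "\<forall>v\<in>half_spin. ?g (?f v) = v"
    proof (intro ballI ext)
      fix v k assume v: "v \<in> half_spin"
      then have h: "v k = 1/2 \<or> v k = -1/2" if "k < 8" for k
        using that unfolding half_spin_def by blast
      have "even (card (?f v) + (if v 7 < 0 then 1 else 0))"
        using v unfolding half_spin_def neg by simp
      then have ev: "even (card (?f v)) \<longleftrightarrow> \<not> v 7 < 0" by (auto split: if_splits)
      show "?g (?f v) k = v k"
      proof -
        consider "k < 7" | "k = 7" | "k \<ge> 8" by linarith
        then show ?thesis
        proof cases
          case 1
          then show ?thesis using h[of k] by (auto simp del: eq_divide_eq_numeral1)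
        next
          case 2
          then show ?thesis using h[of 7] ev by (auto simp del: eq_divide_eq_numeral1)
        next
          case 3
          then show ?thesis using v by (auto simp: half_spin_def)
        qed
      qed
    qed
    have fg: "?f (?g S) = S" if "S \<subseteq> {..<7}" for S
      using that by (auto split: if_splits)
    then show "\<forall>S\<in>Pow {..<7}. ?f (?g S) = S" by blast
    show "?f ` half_spin \<subseteq> Pow {..<7}" by auto
    show "?g ` Pow {..<7} \<subseteq> half_spin"
    proof clarify
      fix S :: "nat set" assume S: "S \<subseteq> {..<7}"
      have "even (card {k. k < 8 \<and> ?g S k < 0})"
        unfolding neg fg[OF S] by auto
      then show "?g S \<in> half_spin" unfolding half_spin_def by auto
    qed
  qed
  then show ?thesis by (simp add: bij_betw_same_card card_Pow)
qed

lemma D_half_disjoint: "D_roots 8 \<inter> half_spin = {}"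
proof -
  have *: "(1/2::real) \<notin> \<int>" "(-1/2::real) \<notin> \<int>"
    using half_int_iff[of 1] Ints_minus[of "-1/2 :: real"] by auto
  have "v 0 \<notin> \<int>" if "v \<in> half_spin" for v
  proof -
    have "(0::nat) < 8" by simp
    with that have "v 0 = 1/2 \<or> v 0 = -1/2" unfolding half_spin_def by blast
    then show ?thesis using * by (elim disjE) (simp_all del: eq_divide_eq_numeral1)
  qed
  then show ?thesis by (auto simp: D_roots_eq Z_lattice_def)
qed

lemma finite_half_spin: "finite half_spin"
  using card_half_spin card.infinite by fastforce

lemma E8_roots_split: "E8_roots = D_roots 8 \<union> half_spin"
  by (simp add: E8_roots_def half_spin_def)

lemma finite_D_roots: "finite (D_roots N)"
  using model_D by (simp add: simply_laced_model_def)

lemma card_E8_roots: "card E8_roots = 240"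
  unfolding E8_roots_split
  by (simp add: card_Un_disjoint D_half_disjoint finite_half_spin finite_D_roots card_half_spin card_D_roots)

text \<open>A root of D_8 has two nonzero entries, so three entries of equal absolute value vanish,
  leaving the 40 roots of D_5. In the half-spin part five signs are free, and parity determines the
  sign of \<open>v 7\<close>, hence the last three entries: 32 more.\<close>

lemma card_E6_roots: "card E6_roots = 72"
proof -
  let ?H = "{v \<in> half_spin. v 5 = v 6 \<and> v 6 = - v 7}"
  have D: "{v \<in> D_roots 8. v 5 = v 6 \<and> v 6 = - v 7} = D_roots 5"
  proof (rule equalityI; rule subsetI)
    fix v assume v: "v \<in> {v \<in> D_roots 8. v 5 = v 6 \<and> v 6 = - v 7}"
    then obtain a b i j where v': "v = (\<lambda>k. a * unit_vec i k + b * unit_vec j k)"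
      by (auto simp: D_roots_def)
    have "v 5 = 0"
    proof (rule ccontr)
      assume "v 5 \<noteq> 0"
      then have nz: "v 5 \<noteq> 0" "v 6 \<noteq> 0" "v 7 \<noteq> 0" using v by auto
      have "k = i \<or> k = j" if "v k \<noteq> 0" for k using that by (auto simp: v' unit_vec_def split: if_splits)
      from this[OF nz(1)] this[OF nz(2)] this[OF nz(3)] show False by auto
    qed
    then have z: "v 5 = 0" "v 6 = 0" "v 7 = 0" using v by auto
    have "v k = 0" if "k \<ge> 5" for k
    proof -
      have "k = 5 \<or> k = 6 \<or> k = 7 \<or> k \<ge> 8" using that by arith
      then show ?thesis using z v by (auto simp: D_roots_eq Z_lattice_def)
    qed
    moreover have "ip 8 v v = ip 5 v v"
      unfolding ip_def by (rule sum.mono_neutral_right) (use calculation in auto)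
    ultimately show "v \<in> D_roots 5" using v by (auto simp: D_roots_eq Z_lattice_def)
  next
    fix v assume v: "v \<in> D_roots 5"
    then have "v k = 0" if "k \<ge> 5" for k using that by (auto simp: D_roots_eq Z_lattice_def)
    moreover have "ip 8 v v = ip 5 v v"
      unfolding ip_def by (rule sum.mono_neutral_right) (use calculation in auto)
    ultimately show "v \<in> {v \<in> D_roots 8. v 5 = v 6 \<and> v 6 = - v 7}"
      using v by (auto simp: D_roots_eq Z_lattice_def)
  qed
  let ?f = "\<lambda>v::nat \<Rightarrow> real. {k. k < 5 \<and> v k < 0}"
  let ?g = "\<lambda>S k. if k < 5 then if k \<in> S then -1/2 else 1/2
                else if k < 7 then if even (card S) then -1/2 else 1/2
                else if k = 7 then if even (card S) then 1/2 else -1/2 else (0::real)"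
  have eight: "k < 8 \<longleftrightarrow> k < 5 \<or> k = 5 \<or> k = 6 \<or> k = 7" for k :: nat by auto
  \<comment> \<open>\<open>v 5\<close> and \<open>v 6\<close> have the sign opposite to
    \<open>v 7\<close>, so the three entries contribute one or two minus signs.\<close>
  have neg: "card {k. k < 8 \<and> v k < 0} = card (?f v) + (if v 7 < 0 then 1 else 2)"
    if "v 5 = v 6" "v 6 = - v 7" "v 7 \<noteq> 0" for v :: "nat \<Rightarrow> real"
  proof -
    have "{k. k < 8 \<and> v k < 0} = (if v 7 < 0 then insert 7 (?f v) else insert 5 (insert 6 (?f v)))"
    proof (cases "v 7 < 0")
      case True
      then have "\<not> v 5 < 0" "\<not> v 6 < 0" using that by linarith+
      then show ?thesis using True by (auto simp: eight)
    next
      case False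
      then have "v 5 < 0" "v 6 < 0" using that by linarith+
      then show ?thesis using False by (auto simp: eight)
    qed
    then show ?thesis by simp
  qed
  have "bij_betw ?f ?H (Pow {..<5})"
  proof (rule bij_betw_byWitness[where f' = ?g])
    show "\<forall>v\<in>?H. ?g (?f v) = v"
    proof (intro ballI ext)
      fix v k assume v: "v \<in> ?H"
      then have h: "v k = 1/2 \<or> v k = -1/2" if "k < 8" for k
        using that unfolding half_spin_def by blast
      have nz: "v 7 \<noteq> 0" using h[of 7] by auto
      have "even (card (?f v) + (if v 7 < 0 then 1 else 2))"
        using v neg[of v] nz unfolding half_spin_def by simp
      then have ev: "even (card (?f v)) \<longleftrightarrow> \<not> v 7 < 0" by (auto split: if_splits)
      show "?g (?f v) k = v k"
      proof -
        consider "k < 5" | "k = 5 \<or> k = 6" | "k = 7" | "k \<ge> 8" by linarith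
        then show ?thesis
        proof cases
          case 1
          then show ?thesis using h[of k] by (auto simp del: eq_divide_eq_numeral1)
        next
          case 2
          then have "v k = - v 7" "5 \<le> k" "k < 7" using v by auto
          then show ?thesis using h[of 7] ev by (auto simp del: eq_divide_eq_numeral1)
        next
          case 3
          then show ?thesis using h[of 7] ev by (auto simp del: eq_divide_eq_numeral1)
        next
          case 4
          then show ?thesis using v by (auto simp: half_spin_def)
        qed
      qed
    qed
    have fg: "?f (?g S) = S" if "S \<subseteq> {..<5}" for S
      using that by (auto split: if_splits)
    then show "\<forall>S\<in>Pow {..<5}. ?f (?g S) = S" by blast
    show "?f ` ?H \<subseteq> Pow {..<5}" by auto
    show "?g ` Pow {..<5} \<subseteq> ?H"
    proof clarify
      fix S :: "nat set" assume S: "S \<subseteq> {..<5}"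
      have "even (card {k. k < 8 \<and> ?g S k < 0})"
        using neg[of "?g S"] fg[OF S] by auto
      then show "?g S \<in> half_spin \<and> ?g S 5 = ?g S 6 \<and> ?g S 6 = - ?g S 7"
        unfolding half_spin_def by auto
    qed
  qed
  then have H: "card ?H = 32" by (simp add: bij_betw_same_card card_Pow)
  have e: "E6_roots = D_roots 5 \<union> ?H" unfolding D[symmetric] E6_roots_def E8_roots_split by blast
  have d: "D_roots 5 \<inter> ?H = {}" unfolding D[symmetric] using D_half_disjoint by blast
  have f: "finite ?H" using finite_half_spin by (rule rev_finite_subset) blast
  have "card E6_roots = card (D_roots 5) + card ?H"
    unfolding e by (rule card_Un_disjoint[OF finite_D_roots f d])
  then show ?thesis unfolding H card_D_roots by simp
qed

subsection \<open>The roots of a Lie algebra\<close>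

lemma sum_apply: "(\<Sum>i\<in>A. f i) x = (\<Sum>i\<in>A. f i x)"
  by (induction A rule: infinite_finite_induct) auto

lemma nat_comb_cone:
  fixes n :: "('a \<Rightarrow> complex) \<Rightarrow> nat"
  assumes "finite S" "S \<subseteq> U"
  shows "(\<lambda>x. \<Sum>\<gamma>\<in>S. of_nat (n \<gamma>) * \<gamma> x) \<in> nat_cone U"
  using assms
proof (induction S)
  case empty
  show ?case using nat_cone.zero[of U] by (simp add: zero_fun_def)
next
  case (insert \<gamma> S)
  have mult: "(\<lambda>x. of_nat k * \<gamma> x) \<in> nat_cone U" for k
  proof (induction k)
    case 0
    show ?case using nat_cone.zero[of U] by (simp add: zero_fun_def)
  next
    case (Suc k)
    have "\<gamma> + (\<lambda>x. of_nat k * \<gamma> x) \<in> nat_cone U"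
      using insert.prems Suc by (intro nat_cone.add) auto
    moreover have "\<gamma> + (\<lambda>x. of_nat k * \<gamma> x) = (\<lambda>x. of_nat (Suc k) * \<gamma> x)"
      by (simp add: fun_eq_iff algebra_simps)
    ultimately show ?case by (simp only:)
  qed
  have "(\<lambda>x. of_nat (n \<gamma>) * \<gamma> x) + (\<lambda>x. \<Sum>\<gamma>\<in>S. of_nat (n \<gamma>) * \<gamma> x) \<in> nat_cone U"
    using insert by (intro nat_cone_plus mult) auto
  moreover have "(\<lambda>x. of_nat (n \<gamma>) * \<gamma> x) + (\<lambda>x. \<Sum>\<gamma>\<in>S. of_nat (n \<gamma>) * \<gamma> x)
      = (\<lambda>x. \<Sum>\<gamma>\<in>insert \<gamma> S. of_nat (n \<gamma>) * \<gamma> x)"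
    using insert by (simp add: fun_eq_iff)
  ultimately show ?case by (simp only:)
qed

context lie_algebra
begin

lemma cartan_number_add: "cartan_number H (x + y) \<alpha> = cartan_number H x \<alpha> + cartan_number H y \<alpha>"
  by (simp add: cartan_number_def dual_form_def algebra_simps add_divide_distrib)

lemma cartan_number_scale: "cartan_number H (\<lambda>t. c * x t) \<alpha> = c * cartan_number H x \<alpha>"
  by (simp add: cartan_number_def dual_form_def)

lemma cartan_number_sum: "cartan_number H (\<Sum>i\<in>A. f i) \<alpha> = (\<Sum>i\<in>A. cartan_number H (f i) \<alpha>)"
proof (induction A rule: infinite_finite_induct)
  case (insert i A)
  show ?case unfolding sum.insert[OF insert.hyps] cartan_number_add insert.IH ..
qed (auto simp: cartan_number_def dual_form_def)

lemma root_reflection_add: "root_reflection H \<alpha> (x + y) = root_reflection H \<alpha> x + root_reflection H \<alpha> y"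
  by (simp add: root_reflection_def cartan_number_add fun_eq_iff algebra_simps)

lemma root_reflection_scale:
  "root_reflection H \<alpha> (\<lambda>t. c * x t) = (\<lambda>t. c * root_reflection H \<alpha> x t)"
  by (simp add: root_reflection_def cartan_number_scale fun_eq_iff algebra_simps)

lemma root_reflection_invol:
  assumes "cartan_number H \<alpha> \<alpha> = 2"
  shows "root_reflection H \<alpha> (root_reflection H \<alpha> x) = x"
proof -
  have "root_reflection H \<alpha> x = x + (\<lambda>t. (- cartan_number H x \<alpha>) * \<alpha> t)"
    by (simp add: root_reflection_def fun_eq_iff)
  then have "cartan_number H (root_reflection H \<alpha> x) \<alpha>
      = cartan_number H x \<alpha> + - cartan_number H x \<alpha> * cartan_number H \<alpha> \<alpha>"
    by (simp only: cartan_number_add cartan_number_scale)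
  then have "cartan_number H (root_reflection H \<alpha> x) \<alpha> = - cartan_number H x \<alpha>"
    unfolding assms by simp
  then show ?thesis by (simp add: root_reflection_def fun_eq_iff)
qed

text \<open>\<open>B\<close> is the inner product of the model pulled back along
  \<open>\<phi>\<close>; norm 2 makes it agree with the Cartan numbers. Finiteness and the closure
  properties of the roots are pulled back as well.\<close>

lemma simply_laced_of_root_system:
  fixes H P and \<alpha> :: "nat \<Rightarrow> 'a \<Rightarrow> complex"
  assumes type: "has_root_system H \<Phi>" and M: "simply_laced_model N \<Phi>"
    and positive: "positive_system (roots H) P"
    and enum: "bij_betw \<alpha> I (simple_roots P)"
  obtains B where "simply_laced (roots H) P B I \<alpha> (\<lambda>i. root_reflection H (\<alpha> i))"
    "\<And>x y. x \<in> roots H \<Longrightarrow> y \<in> roots H \<Longrightarrow> cartan_number H x y = of_real (B x y)"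
    "card (roots H) = card \<Phi>"
proof -
  let ?R = "roots H"
  obtain \<phi> :: "('a \<Rightarrow> complex) \<Rightarrow> nat \<Rightarrow> real" where lin: "Vector_Spaces.linear real_scale real_scale \<phi>"
    and inj: "inj_on \<phi> (module.span real_scale ?R)" and im: "\<phi> ` ?R = \<Phi>"
    and cart: "\<And>x y. x \<in> ?R \<Longrightarrow> y \<in> ?R \<Longrightarrow>
      cartan_number H x y = of_real (2 * dot (\<phi> x) (\<phi> y) / dot (\<phi> y) (\<phi> y))"
    using type unfolding has_root_system_def by blast
  interpret \<phi>: Vector_Spaces.linear real_scale real_scale \<phi> by (rule lin)
  define B where "B = (\<lambda>x y. ip N (\<phi> x) (\<phi> y))"
  have \<phi>R: "\<phi> x \<in> \<Phi>" if "x \<in> ?R" for x using im that by blast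
  have supp: "\<phi> x k = 0" if "x \<in> ?R" "k \<ge> N" for x k
    using M \<phi>R[OF that(1)] that(2) by (simp add: simply_laced_model_def)
  have B2: "B x x = 2" if "x \<in> ?R" for x
    using M \<phi>R[OF that] by (simp add: simply_laced_model_def B_def)
  have cartB: "cartan_number H x y = of_real (B x y)" if "x \<in> ?R" "y \<in> ?R" for x y
    using cart[OF that] dot_eq_ip[of N "\<phi> x" "\<phi> y"] dot_eq_ip[of N "\<phi> y" "\<phi> y"] supp that B2[OF that(2)]
    by (simp add: B_def)
  \<comment> \<open>Negatives and differences of roots lie in the real span, where
    \<open>\<phi>\<close> is injective, so an image in \<open>\<Phi>\<close> identifies them as
    roots.\<close>
  have inR: "z \<in> ?R" if z: "z \<in> \<phi>.vs1.span ?R" "\<phi> z \<in> \<Phi>" for z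
  proof -
    obtain w where "w \<in> ?R" "\<phi> w = \<phi> z" using z(2) im by (metis imageE)
    then show ?thesis using inj z(1) \<phi>.vs1.span_base by (metis inj_onD)
  qed
  have injR: "x = y" if "x \<in> ?R" "y \<in> ?R" "\<phi> x = \<phi> y" for x y
    using inj that \<phi>.vs1.span_base by (metis inj_onD)
  have neg: "- x \<in> ?R" if "x \<in> ?R" for x
  proof (rule inR)
    show "- x \<in> \<phi>.vs1.span ?R" using that \<phi>.vs1.span_base \<phi>.vs1.span_neg by blast
    show "\<phi> (- x) \<in> \<Phi>" using M \<phi>R[OF that] by (simp add: \<phi>.neg simply_laced_model_def)
  qed
  have diff: "x - y \<in> ?R" if "x \<in> ?R" "y \<in> ?R" "B x y = 1" for x y
  proof (rule inR)
    show "x - y \<in> \<phi>.vs1.span ?R" using that \<phi>.vs1.span_base \<phi>.vs1.span_diff by blast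
    show "\<phi> (x - y) \<in> \<Phi>"
      using M \<phi>R[OF that(1)] \<phi>R[OF that(2)] that(3) by (simp add: \<phi>.diff simply_laced_model_def B_def)
  qed
  have vals: "B x y \<in> {-1, 0, 1}" if "x \<in> ?R" "y \<in> ?R" "x \<noteq> y" "x \<noteq> - y" for x y
    unfolding B_def
  proof (rule model_values[OF M \<phi>R[OF that(1)] \<phi>R[OF that(2)]])
    show "\<phi> x \<noteq> \<phi> y" using injR that by blast
    show "\<phi> x \<noteq> - \<phi> y" using injR[OF that(1) neg[OF that(2)]] that(4) \<phi>.neg by metis
  qed
  have "inj_on \<phi> ?R" using injR by (auto intro: inj_onI)
  then have card: "card ?R = card \<Phi>" and fin: "finite ?R"
    using im M card_image finite_imageD unfolding simply_laced_model_def by metis+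
  have \<alpha>R: "\<alpha> i \<in> ?R" if "i \<in> I" for i
    using enum that positive unfolding bij_betw_def simple_roots_def positive_system_def by blast
  have "simply_laced ?R P B I \<alpha> (\<lambda>i. root_reflection H (\<alpha> i))"
  proof
    show "finite ?R" by (rule fin)
    show "B (x + y) z = B x z + B y z" for x y z by (simp add: B_def \<phi>.add ip_add)
    show "B x y = B y x" for x y by (simp add: B_def ip_sym)
    show "P \<union> uminus ` P = ?R" "P \<inter> uminus ` P = {}" using positive by (auto simp: positive_system_def)
    show "x + y \<in> P" if "x \<in> P" "y \<in> P" "x + y \<in> ?R" for x y
      using positive that by (simp add: positive_system_def)
    show "bij_betw \<alpha> I {x \<in> P. \<not> (\<exists>y\<in>P. \<exists>z\<in>P. x = y + z)}"
      using enum by (simp add: simple_roots_def)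
    show "root_reflection H (\<alpha> i) (x + y) = root_reflection H (\<alpha> i) x + root_reflection H (\<alpha> i) y" for i x y
      by (rule root_reflection_add)
    show "root_reflection H (\<alpha> i) (root_reflection H (\<alpha> i) x) = x" if "i \<in> I" for i x
      using cartB[OF \<alpha>R[OF that] \<alpha>R[OF that]] B2[OF \<alpha>R[OF that]] by (intro root_reflection_invol) simp
    show "root_reflection H (\<alpha> i) x = (if B x (\<alpha> i) = 0 then x else if B x (\<alpha> i) = 1 then x - \<alpha> i
               else if B x (\<alpha> i) = -1 then x + \<alpha> i else - x)" if ix: "i \<in> I" "x \<in> ?R" for i x
    proof -
      have eq: "root_reflection H (\<alpha> i) x = (\<lambda>t. x t - of_real (B x (\<alpha> i)) * \<alpha> i t)"
        by (simp add: root_reflection_def cartB[OF ix(2) \<alpha>R[OF ix(1)]])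
      consider "B x (\<alpha> i) = 0" | "B x (\<alpha> i) = 1" | "B x (\<alpha> i) = -1" | "x = \<alpha> i" | "x = - \<alpha> i"
        using vals[OF ix(2) \<alpha>R[OF ix(1)]] by blast
      then show ?thesis
      proof cases
        case 4
        then have 2: "B x (\<alpha> i) = 2" using B2[OF \<alpha>R[OF ix(1)]] by simp
        have "root_reflection H (\<alpha> i) x = - x" unfolding eq 2 by (simp add: 4 fun_eq_iff)
        then show ?thesis using 2 by simp
      next
        case 5
        then have 2: "B x (\<alpha> i) = - 2" using B2[OF \<alpha>R[OF ix(1)]] by (simp add: B_def \<phi>.neg ip_minus)
        have "root_reflection H (\<alpha> i) x = - x" unfolding eq 2 by (simp add: 5 fun_eq_iff)
        then show ?thesis using 2 by simp
      qed (auto simp: eq fun_eq_iff)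
    qed
  qed (use B2 diff vals in auto)
  then show thesis using that cartB card by blast
qed

section \<open>The dual of the Cartan subalgebra\<close>

lemma function_space: "vector_space (\<lambda>(c::complex) (f::'a \<Rightarrow> complex) t. c * f t)"
  by unfold_locales (auto simp: fun_eq_iff algebra_simps)

lemma dual_sum:
  assumes H: "subspace H" and f: "f \<in> dual H" and A: "finite A" "A \<subseteq> H"
  shows "f (\<Sum>b\<in>A. c b *s b) = (\<Sum>b\<in>A. c b * f b)"
  using A
proof (induction A)
  case empty
  have "f (0 *s 0) = 0 * f 0" using f subspace_0[OF H] unfolding dual_def by blast
  then show ?case by simp
next
  case (insert b A)
  have "c b *s b \<in> H" "(\<Sum>b\<in>A. c b *s b) \<in> H"
    using insert H by (auto intro!: subspace_scale subspace_sum)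
  then show ?case using insert f by (simp add: dual_def)
qed

lemma dual_subset_span:
  assumes H: "subspace H" and l: "dim H > 0"
  obtains D where "finite D" "card D \<le> dim H"
    "dual H \<subseteq> module.span (\<lambda>c f t. c * f t) D"
proof -
  interpret fv: vector_space "\<lambda>(c::complex) (f::'a \<Rightarrow> complex) t. c * f t" by (rule function_space)
  obtain E where E: "E \<subseteq> H" "independent E" "H \<subseteq> span E" "card E = dim H" by (rule basis_exists)
  have finE: "finite E" using E(4) l by (simp add: card_ge_0_finite)
  \<comment> \<open>Coordinate functionals of a basis of \<open>H\<close>, extended by 0 as the
    encoding of \<open>dual\<close> demands.\<close>
  define d where "d = (\<lambda>b t. if t \<in> H then representation E t b else 0)"
  have "f \<in> fv.span (d ` E)" if f: "f \<in> dual H" for f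
  proof -
    have "f = (\<Sum>b\<in>E. (\<lambda>t. f b * d b t))"
    proof
      fix t
      show "f t = (\<Sum>b\<in>E. (\<lambda>t. f b * d b t)) t"
      proof (cases "t \<in> H")
        case True
        then have "f t = f (\<Sum>b\<in>E. representation E t b *s b)"
          using sum_representation_eq[OF E(2) _ finE, of t] E(3) by auto
        also have "\<dots> = (\<Sum>b\<in>E. representation E t b * f b)"
          by (rule dual_sum[OF H f finE E(1)])
        finally show ?thesis using True by (simp add: d_def sum_apply mult.commute)
      next
        case False
        then show ?thesis using f by (simp add: d_def sum_apply dual_def)
      qed
    qed
    moreover have "(\<Sum>b\<in>E. (\<lambda>t. f b * d b t)) \<in> fv.span (d ` E)"
      by (intro fv.span_sum fv.span_scale fv.span_base) auto
    ultimately show ?thesis by metis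
  qed
  then show thesis using that[of "d ` E"] finE E(4) card_image_le[OF finE, of d] by auto
qed

text \<open>The simple roots are independent because their Gram matrix is nondegenerate, so by the rank
  they form a basis of the dual of \<open>H\<close>.\<close>

lemma dual_subset_span_simple_roots:
  fixes \<alpha> :: "nat \<Rightarrow> 'a \<Rightarrow> complex"
  assumes H: "subspace H" and l: "dim H = l" "l > 0"
    and sl: "simply_laced (roots H) P B {1..l} \<alpha> s"
    and cart: "\<And>x y. x \<in> roots H \<Longrightarrow> y \<in> roots H \<Longrightarrow> cartan_number H x y = of_real (B x y)"
  shows "dual H \<subseteq> module.span (\<lambda>c f t. c * f t) (\<alpha> ` {1..l})"
proof
  interpret fv: vector_space "\<lambda>(c::complex) (f::'a \<Rightarrow> complex) t. c * f t" by (rule function_space)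
  interpret sl: simply_laced "roots H" P B "{1..l}" \<alpha> s by (rule sl)
  have inj: "inj_on \<alpha> {1..l}" using sl.\<alpha>_inj by (auto intro: inj_onI)
  have indep: "fv.independent (\<alpha> ` {1..l})"
  proof
    assume "fv.dependent (\<alpha> ` {1..l})"
    then obtain u where u: "\<exists>v\<in>\<alpha> ` {1..l}. u v \<noteq> 0" "(\<Sum>v\<in>\<alpha> ` {1..l}. (\<lambda>t. u v * v t)) = 0"
      using fv.dependent_finite[of "\<alpha> ` {1..l}"] by auto
    have z: "(\<Sum>i\<in>{1..l}. (\<lambda>t. u (\<alpha> i) * \<alpha> i t)) = 0" using u(2) inj by (simp add: sum.reindex)
    \<comment> \<open>Pairing the relation with each simple root puts its coefficients in the kernel
      of the Gram matrix. They are complex and the matrix is real, so real and imaginary parts are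
      treated separately.\<close>
    have rel: "(\<Sum>i\<in>{1..l}. u (\<alpha> i) * of_real (B (\<alpha> i) (\<alpha> j))) = 0" if "j \<in> {1..l}" for j
    proof -
      have "cartan_number H (\<Sum>i\<in>{1..l}. (\<lambda>t. u (\<alpha> i) * \<alpha> i t)) (\<alpha> j) = 0"
        unfolding z by (simp add: cartan_number_def dual_form_def)
      then show ?thesis
        using cart sl.\<alpha>_R that by (simp add: cartan_number_sum cartan_number_scale)
    qed
    have "Re (u (\<alpha> i)) = 0" "Im (u (\<alpha> i)) = 0" if "i \<in> {1..l}" for i
      using arg_cong[OF rel, of _ Re] arg_cong[OF rel, of _ Im]
        sl.Gram_nondegenerate[of "\<lambda>i. Re (u (\<alpha> i))" i] sl.Gram_nondegenerate[of "\<lambda>i. Im (u (\<alpha> i))" i] that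
      by simp_all
    then show False using u(1) by (auto simp: complex_eq_iff)
  qed
  have sub: "\<alpha> ` {1..l} \<subseteq> dual H" using sl.\<alpha>_R by (auto simp: roots_def)
  fix f assume f: "f \<in> dual H"
  show "f \<in> fv.span (\<alpha> ` {1..l})"
  proof (rule ccontr)
    assume nf: "f \<notin> fv.span (\<alpha> ` {1..l})"
    then have i: "fv.independent (insert f (\<alpha> ` {1..l}))" using indep by (rule fv.independent_insertI)
    obtain D where D: "finite D" "card D \<le> dim H" "dual H \<subseteq> fv.span D"
      using dual_subset_span[OF H] l by auto
    have "card (insert f (\<alpha> ` {1..l})) \<le> card D"
      using fv.independent_span_bound[OF D(1) i] D(3) f sub by blast
    moreover have "f \<notin> \<alpha> ` {1..l}" using nf fv.span_base by blast
    then have "card (insert f (\<alpha> ` {1..l})) = Suc l" using inj by (simp add: card_image)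
    ultimately show False using D(2) l by simp
  qed
qed

text \<open>For odd rank (A and E7) an even \<open>m * l\<close> forces \<open>m\<close> to be even.
  For D, E6 and E8 the quotient is computed: 2(l - 1), 12 and 30.\<close>

lemma model_of_type:
  assumes "(odd l \<and> has_root_system H (A_roots l)) \<or>
               (l \<ge> 4 \<and> has_root_system H (D_roots l)) \<or>
               (l = 6 \<and> has_root_system H E6_roots) \<or>
               (l = 7 \<and> has_root_system H E7_roots) \<or>
               (l = 8 \<and> has_root_system H E8_roots)"
  obtains \<Phi> N where "simply_laced_model N \<Phi>" "has_root_system H \<Phi>" "l > 0"
    "\<And>m. even (card \<Phi>) \<Longrightarrow> card \<Phi> = m * l \<Longrightarrow> even m"
  using assms
proof (elim disjE conjE)
  assume *: "odd l" "has_root_system H (A_roots l)"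
  show thesis by (rule that[OF model_A *(2)]) (use *(1) in \<open>auto simp: odd_pos\<close>)
next
  assume *: "l \<ge> 4" "has_root_system H (D_roots l)"
  have "even m" if "card (D_roots l) = m * l" for m
  proof -
    have "2 * (l - 1) * l = m * l" using that unfolding card_D_roots by (simp add: mult_ac)
    then have "m = 2 * (l - 1)" using *(1) by simp
    then show ?thesis by simp
  qed
  then show thesis using that[OF model_D *(2)] *(1) by simp
next
  assume *: "l = 6" "has_root_system H E6_roots"
  show thesis by (rule that[OF model_E6 *(2)]) (use *(1) in \<open>auto simp: card_E6_roots\<close>)
next
  assume *: "l = 7" "has_root_system H E7_roots"
  show thesis by (rule that[OF model_E7 *(2)]) (use *(1) in auto)
next
  assume *: "l = 8" "has_root_system H E8_roots"
  show thesis by (rule that[OF model_E8 *(2)]) (use *(1) in \<open>auto simp: card_E8_roots\<close>)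
qed

end

theorem theorem1p9:
  fixes scale :: "complex \<Rightarrow> 'a::ab_group_add \<Rightarrow> 'a"
    and bracket :: "'a \<Rightarrow> 'a \<Rightarrow> 'a"
    and H :: "'a set"
    and l :: nat
    and P :: "('a \<Rightarrow> complex) set"
    and \<alpha> :: "nat \<Rightarrow> 'a \<Rightarrow> complex"
    and \<psi> :: "'a \<Rightarrow> complex"
    and I1 I2 :: "nat set"
    and \<Delta> :: "('a \<Rightarrow> complex) set"
    and form :: "('a \<Rightarrow> complex) \<Rightarrow> ('a \<Rightarrow> complex) \<Rightarrow> complex"
    and s :: "nat \<Rightarrow> ('a \<Rightarrow> complex) \<Rightarrow> ('a \<Rightarrow> complex)"
    and \<tau>1 \<tau>2 \<sigma> :: "('a \<Rightarrow> complex) \<Rightarrow> ('a \<Rightarrow> complex)"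
    and Z :: "(('a \<Rightarrow> complex) \<Rightarrow> ('a \<Rightarrow> complex)) set"
    and h :: nat
    and g :: real
    and \<beta> :: "nat \<Rightarrow> 'a \<Rightarrow> complex"
  defines "\<Delta> \<equiv> lie_algebra.roots scale bracket H"
    and "form \<equiv> lie_algebra.dual_form scale bracket H"
    and "s \<equiv> \<lambda>i. lie_algebra.root_reflection scale bracket H (\<alpha> i)"
    and "\<tau>1 \<equiv> ordered_product s I1"
    and "\<tau>2 \<equiv> ordered_product s I2"
    and "\<sigma> \<equiv> \<tau>2 \<circ> \<tau>1"
    and "Z \<equiv> cyclic_group \<sigma>"
    and "h \<equiv> order_on (lie_algebra.dual scale H) \<sigma>"
    and "g \<equiv> real h / 2"
    and "\<beta> \<equiv> \<lambda>i. if i \<in> I1 then \<alpha> i else - \<alpha> i"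
  assumes lie: "lie_algebra scale bracket"
    and fin_dim: "lie_algebra.finite_dimensional scale"
    and simple: "lie_algebra.simple scale bracket"
    and cartan: "lie_algebra.cartan_subalgebra scale bracket H"
    and rank: "vector_space.dim scale H = l"
    and type: "(odd l \<and> lie_algebra.has_root_system scale bracket H (A_roots l)) \<or>
               (l \<ge> 4 \<and> lie_algebra.has_root_system scale bracket H (D_roots l)) \<or>
               (l = 6 \<and> lie_algebra.has_root_system scale bracket H E6_roots) \<or>
               (l = 7 \<and> lie_algebra.has_root_system scale bracket H E7_roots) \<or>
               (l = 8 \<and> lie_algebra.has_root_system scale bracket H E8_roots)"
    and positive: "positive_system \<Delta> P"
    and simple_enum: "bij_betw \<alpha> {1..l} (simple_roots P)"
    and highest: "highest_root \<Delta> P \<psi>"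
    and partition: "I1 \<union> I2 = {1..l}" "I1 \<inter> I2 = {}"
    and orthogonal1: "\<And>i j. i \<in> I1 \<Longrightarrow> j \<in> I1 \<Longrightarrow> i \<noteq> j \<Longrightarrow> form (\<alpha> i) (\<alpha> j) = 0"
    and orthogonal2: "\<And>i j. i \<in> I2 \<Longrightarrow> j \<in> I2 \<Longrightarrow> i \<noteq> j \<Longrightarrow> form (\<alpha> i) (\<alpha> j) = 0"
    and orthogonal_highest: "\<And>i. i \<in> I2 \<Longrightarrow> form (\<alpha> i) \<psi> = 0"
  shows "(\<forall>i\<in>{1..l}. real (card (P \<inter> orbit_of Z (\<beta> i))) = g) \<and>
         P = (\<Union>i\<in>{1..l}. P \<inter> orbit_of Z (\<beta> i)) \<and>
         disjoint_family_on (\<lambda>i. P \<inter> orbit_of Z (\<beta> i)) {1..l}"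
proof -
  interpret lie_algebra scale bracket by (rule lie)
  obtain \<Phi> N where M: "simply_laced_model N \<Phi>" and RS: "has_root_system H \<Phi>" and l: "l > 0"
    and even_m: "\<And>m. even (card \<Phi>) \<Longrightarrow> card \<Phi> = m * l \<Longrightarrow> even m"
    using model_of_type[OF type] by blast
  note positive' = positive[unfolded \<Delta>_def]
  obtain B where sl: "simply_laced \<Delta> P B {1..l} \<alpha> s"
    and cart: "\<And>x y. x \<in> \<Delta> \<Longrightarrow> y \<in> \<Delta> \<Longrightarrow> cartan_number H x y = of_real (B x y)"
    and card_\<Delta>: "card \<Delta> = card \<Phi>"
    unfolding \<Delta>_def s_def by (rule simply_laced_of_root_system[OF RS M positive' simple_enum]) blast
  interpret sl: simply_laced \<Delta> P B "{1..l}" \<alpha> s by (rule sl)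
  have H: "subspace H" using cartan by (simp add: cartan_subalgebra_def subalgebra_def)
  have simples: "simple_roots P = \<alpha> ` {1..l}" using simple_enum by (simp add: bij_betw_def)
  have \<psi>: "\<psi> \<in> \<Delta>" "\<psi> - \<alpha> k \<in> nat_cone (\<alpha> ` {1..l})" if k: "k \<in> {1..l}" for k
  proof -
    show "\<psi> \<in> \<Delta>" using highest by (simp add: highest_root_def)
    obtain n :: "('a \<Rightarrow> complex) \<Rightarrow> nat"
      where n: "\<psi> = (\<lambda>x. \<alpha> k x + (\<Sum>\<gamma>\<in>simple_roots P. of_nat (n \<gamma>) * \<gamma> x))"
      using highest sl.\<alpha>_R[OF k] unfolding highest_root_def by blast
    have "\<psi> - \<alpha> k = (\<lambda>x. \<Sum>\<gamma>\<in>simple_roots P. of_nat (n \<gamma>) * \<gamma> x)"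
      unfolding n by (simp add: fun_eq_iff)
    then show "\<psi> - \<alpha> k \<in> nat_cone (\<alpha> ` {1..l})"
      using nat_comb_cone[of "simple_roots P" "\<alpha> ` {1..l}" n] by (simp add: simples)
  qed
  have fin: "finite I1" "finite I2" using partition(1) by (metis finite_Un finite_atLeastAtMost)+
  have form_0: "B (\<alpha> i) (\<alpha> j) = 0" if "i \<in> {1..l}" "j \<in> {1..l}" "form (\<alpha> i) (\<alpha> j) = 0" for i j
  proof -
    have "cartan_number H (\<alpha> i) (\<alpha> j) = 0" using that(3) by (simp add: cartan_number_def form_def)
    then show ?thesis using cart[of "\<alpha> i" "\<alpha> j"] sl.\<alpha>_R that by simp
  qed
  have orth: "B (\<alpha> i) (\<alpha> j) = 0" if "i \<in> I1 \<and> j \<in> I1 \<or> i \<in> I2 \<and> j \<in> I2" "i \<noteq> j" for i j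
    using that orthogonal1[of i j] orthogonal2[of i j] partition(1) by (intro form_0) blast+
  \<comment> \<open>\<open>ordered_product\<close> multiplies along the sorted list, so with these
    lists the partial Coxeter elements are literally the words of the locale.\<close>
  interpret bip: bipartite \<Delta> P B "{1..l}" \<alpha> s "sorted_list_of_set I1" "sorted_list_of_set I2"
  proof
    show "\<exists>i\<in>J. \<exists>j\<in>{1..l}-J. B (\<alpha> i) (\<alpha> j) = -1" if "J \<subseteq> {1..l}" "J \<noteq> {}" "J \<noteq> {1..l}" for J
      using sl.connected_of_highest[OF \<psi>(1) \<psi>(2) that, of 1] l by auto
  qed (use fin partition l orth in auto)
  obtain m where m: "m > 0"
    "\<And>e t i. t < m \<Longrightarrow> i \<in> set (bip.part (e + t)) \<Longrightarrow> bip.alt e t (\<alpha> i) \<in> P"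
    "\<And>e x. x \<in> P \<Longrightarrow> - bip.alt e m x \<in> P"
    using bip.alternating_length by blast
  interpret len: bipartite_length \<Delta> P B "{1..l}" \<alpha> s "sorted_list_of_set I1" "sorted_list_of_set I2" m
    by unfold_locales (use m in auto)
  have \<sigma>: "\<sigma> = len.cox"
    by (simp add: fun_eq_iff \<sigma>_def \<tau>1_def \<tau>2_def ordered_product_def len.cox_def bip.part_def sl.word_def)
  have \<beta>: "\<beta> = len.\<beta>"
    using fin by (simp add: fun_eq_iff \<beta>_def len.\<beta>_def)
  have card: "card \<Delta> = m * l" "even (card \<Delta>)"
  proof -
    have "card \<Delta> = card P + card (uminus ` P)"
      unfolding sl.R_eq[symmetric] using sl.finite_P sl.P_disj by (intro card_Un_disjoint) auto
    also have "card (uminus ` P) = card P" by (intro card_image) (simp add: inj_on_def)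
    finally have c: "card \<Delta> = 2 * card P" by simp
    then show "card \<Delta> = m * l" using len.card_P by simp
    show "even (card \<Delta>)" using c by simp
  qed
  have even: "even m" using even_m[of m] card card_\<Delta> by simp
  have h: "h = m"
    unfolding h_def order_on_def
  proof (rule Least_equality)
    interpret fv: vector_space "\<lambda>(c::complex) (f::'a \<Rightarrow> complex) t. c * f t" by (rule function_space)
    have s_scale: "s i (\<lambda>t. c * x t) = (\<lambda>t. c * s i x t)" for i c x
      by (simp add: s_def root_reflection_scale)
    have word_scale: "sl.word ws (\<lambda>t. c * x t) = (\<lambda>t. c * sl.word ws x t)" for ws c x
      by (induction ws) (simp_all add: s_scale)
    have \<sigma>_add: "(\<sigma> ^^ k) (x + y) = (\<sigma> ^^ k) x + (\<sigma> ^^ k) y" for k x y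
    proof (induction k)
      case (Suc k)
      show ?case
        unfolding funpow.simps comp_apply Suc.IH
        unfolding \<sigma> len.cox_def additive.add[OF sl.additive_word] ..
    qed simp
    have \<sigma>_scale: "(\<sigma> ^^ k) (\<lambda>t. c * x t) = (\<lambda>t. c * (\<sigma> ^^ k) x t)" for k c x
      by (induction k) (simp_all add: \<sigma> len.cox_def word_scale)
    have "(\<sigma> ^^ m) x = x" if "x \<in> dual H" for x
    proof -
      \<comment> \<open>The fixed vectors form a complex subspace containing the simple roots, hence
        the whole dual.\<close>
      have "fv.subspace {x. (\<sigma> ^^ m) x = x}"
      proof (rule fv.subspaceI)
        show "0 \<in> {x. (\<sigma> ^^ m) x = x}" using \<sigma>_add[of m 0 0] by simp
      qed (simp_all add: \<sigma>_add \<sigma>_scale)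
      moreover have "\<alpha> ` {1..l} \<subseteq> {x. (\<sigma> ^^ m) x = x}"
        using len.cox_order sl.\<alpha>_R by (auto simp: \<sigma>)
      ultimately have "fv.span (\<alpha> ` {1..l}) \<subseteq> {x. (\<sigma> ^^ m) x = x}" by (rule fv.span_minimal[rotated])
      then show ?thesis
        using dual_subset_span_simple_roots[OF H rank l sl[unfolded \<Delta>_def] cart[unfolded \<Delta>_def]] that
        by blast
    qed
    then show "0 < m \<and> (\<forall>x\<in>dual H. (\<sigma> ^^ m) x = x)" using m(1) by blast
    \<comment> \<open>Roots belong to the dual, so a power trivial there is trivial on the
      roots.\<close>
    show "m \<le> n" if "0 < n \<and> (\<forall>x\<in>dual H. (\<sigma> ^^ n) x = x)" for n
      by (rule len.cox_order_minimal) (use that in \<open>auto simp: \<sigma> \<Delta>_def roots_def\<close>)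
  qed
  have "real (card (P \<inter> orbit_of Z (\<beta> i))) = g" if "i \<in> {1..l}" for i
    using len.card_positive_orbit[OF even that] by (simp add: Z_def \<sigma> \<beta> g_def h)
  moreover have "P = (\<Union>i\<in>{1..l}. P \<inter> orbit_of Z (\<beta> i))"
    unfolding Z_def \<sigma> \<beta> by (rule len.P_eq_Union_orbits)
  moreover have "disjoint_family_on (\<lambda>i. P \<inter> orbit_of Z (\<beta> i)) {1..l}"
    unfolding Z_def \<sigma> \<beta> by (rule len.disjoint_positive_orbits)
  ultimately show ?thesis by blast
qed

end
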